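(* Suppose $R$ is the indicator function of a convex closed set $K\subset\mathbb R^n$ that is closed under permutations of coordinates and that either satisfies $K\subseteq\mathbb R^n_+$ or is closed under coordinate-wise sign-flips, and suppose that $\mathrm{nnz}(x^* )\le s$ for some $s\ll n$. Then Algorithm 1 of the context admits an implementation, in which each $w_i$ is obtained by the sparse weak-proximal step described in the context, such that, given the initial information $x_t,\nabla f(x_t),\nabla^2f(x_t)x_t$, each iteration requires: 1. a single projection computation of an $s$-dimensional vector onto an $s$-dimensional restriction $K_T$ ($|T|=s$) of the set $K$ (e.g., if $K$ is an $\ell_p$ ball in $\mathbb R^n$, then the projection is onto the $\ell_p$ ball in $\mathbb R^s$); 2. a single computation of the product of $\nabla^2f(x_t)$ with an $s$-sparse vector (a vector in $\mathbb R^n$ with at most $s$ nonzero entries); 3. additional $O(n\log s)$ time.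
   Context: Problem: $\min_{x\in\mathbb R^n}F(x)=f(x)+R(x)$, with Euclidean norm $\|\cdot\|$; $R$ is proper closed convex, $f$ is convex and twice continuously differentiable over $\mathrm{dom}(R)$ with $\|\nabla^2f(x)-\nabla^2f(y)\|\le\beta_2\|x-y\|$ for $x,y\in\mathrm{dom}(R)$. $F$ is bounded below with optimal value $F^*$ and unique minimizer $x^*$. One of the following holds. Assumption A: for an initialization point $x_1\in\mathrm{dom}(R)$ there are $\alpha,\beta>0$ with $\beta I\succeq\nabla^2f(x)\succeq\alpha I$ for all $x$ with $F(x)\le F(x_1)$. Assumption B: $\mathrm{dom}(R)$ has finite Euclidean diameter $D$ and $\|x-x^*\|^2\le\frac2\alpha(F(x)-F^* )$ for all $x\in\mathrm{dom}(R)$, for some $\alpha>0$; then $\beta$ denotes the Lipschitz constant of $\nabla f$ over $\mathrm{dom}(R)$. Fix $x_t\in\mathrm{dom}(R)$, an iterate of a method that started at $x_1$ and never increases $F$. Under Assumption A, $Q_t(w)=\langle w-x_t,\nabla f(x_t)\rangle+\frac12\langle w-x_t,\nabla^2f(x_t)(w-x_t)\rangle$; under Assumption B, $Q_t$ is this expression plus $\frac{\beta_2}{6}\|w-x_t\|^3$. Put $\phi_t=Q_t+R$. The constant $\tilde\beta$ denotes the Lipschitz constant of $\nabla Q_t$ over $\mathrm{dom}(R)$, and is set to $\tilde\beta=\beta$ if Assumption A holds and to $\tilde\beta=\beta+\frac{\beta_2D}{2}$ if Assumption B holds. Let $$\psi_{y,\lambda}(z)=\langle z-y,\nabla Q_t(y)\rangle+\frac{\lambda\tilde\beta}{2}\|z-y\|^2+R(z).$$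 A first-order weak proximal oracle (WPO) for $\phi_t$ is a map which, given $(y,\lambda)\in\mathrm{dom}(R)\times\mathbb R_+$, outputs $w\in\mathrm{dom}(R)$ with $\psi_{y,\lambda}(w)\le\min\{\psi_{y,\lambda}(x^* ),\psi_{y,\lambda}(y)\}$. Algorithm 1: $y_1=x_t$; for $i=1,2,\dots$: choose $\lambda_i\in[0,1]$, let $w_i$ be the output of a WPO on input $(y_i,\lambda_i)$, and set $y_{i+1}=(1-\lambda_i)y_i+\lambda_iw_i$. Notation: $\mathrm{nnz}(x)$ is the number of nonzero entries of $x$. For $T\subseteq[n]=\{1,\dots,n\}$, $x_T\in\mathbb R^{|T|}$ is the restriction of $x$ to the coordinates in $T$; $I_T$ is the $n\times|T|$ matrix obtained from the identity by deleting the columns not indexed by $T$; $K_T=\{u\in\mathbb R^{|T|}: I_Tu\in K\}$; $\Pi_{K_T}$ is the Euclidean projection onto $K_T$. Sparse weak-proximal step (its output is a valid output of a WPO on input $(y_i,\lambda_i)$): set $z=y_i-\frac{1}{\lambda_i\tilde\beta}\nabla Q_t(y_i)$; let $T$ be a set of $s$ largest (signed) entries of $z$ if $K\subseteq\mathbb R^n_+$, or of $s$ largest-in-absolute-value entries of $z$ if $K$ is closed under sign-flips; set $z'=I_T\Pi_{K_T}[z_T]$; take $w_i\in\arg\min_{u\in\{y_i,z'\}}\psi_{y_i,\lambda_i}(u)$. *)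

theory Defs
  imports "HOL-Analysis.Analysis"
begin

section \<open>Euclidean n-space for a variable dimension\<close>

text \<open>
  The implementation below has to be one program for all dimensions, so the dimension cannot be a
  type. Points of n-space are the elements of the topological space Euclidean_space n, that is
  functions on the naturals that vanish from index n on; coordinates are numbered from 0.
  The metric-space instance of the function type is not the Euclidean metric, so the norm is
  written with L2_set.
\<close>

type_synonym vec = "nat \<Rightarrow> real"

abbreviation Rn :: "nat \<Rightarrow> vec set" where
  "Rn n \<equiv> topspace (Euclidean_space n)"

definition inner_n :: "nat \<Rightarrow> vec \<Rightarrow> vec \<Rightarrow> real" where
  "inner_n n x y = (\<Sum>i<n. x i * y i)"

definition norm_n :: "nat \<Rightarrow> vec \<Rightarrow> real" where
  "norm_n n x = L2_set x {..<n}"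

definition vdiff :: "vec \<Rightarrow> vec \<Rightarrow> vec" where
  "vdiff x y = (\<lambda>i. x i - y i)"

definition mat_vec :: "nat \<Rightarrow> (nat \<Rightarrow> nat \<Rightarrow> real) \<Rightarrow> vec \<Rightarrow> vec" where
  "mat_vec n A x = (\<lambda>i. if i < n then (\<Sum>j<n. A i j * x j) else 0)"

definition opnorm :: "nat \<Rightarrow> (nat \<Rightarrow> nat \<Rightarrow> real) \<Rightarrow> real" where
  "opnorm n A = (SUP v\<in>Rn n. norm_n n (mat_vec n A v) / norm_n n v)"

definition comb :: "real \<Rightarrow> vec \<Rightarrow> vec \<Rightarrow> vec" where
  "comb a x y = (\<lambda>i. (1 - a) * x i + a * y i)"

definition nnz :: "nat \<Rightarrow> vec \<Rightarrow> nat" where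
  "nnz n x = card {i. i < n \<and> x i \<noteq> 0}"

definition diameter_n :: "nat \<Rightarrow> vec set \<Rightarrow> real" where
  "diameter_n n S = (SUP (x, y)\<in>S \<times> S. norm_n n (vdiff x y))"

definition bounded_n :: "nat \<Rightarrow> vec set \<Rightarrow> bool" where
  "bounded_n n S \<longleftrightarrow> (\<exists>b. \<forall>x\<in>S. \<forall>y\<in>S. norm_n n (vdiff x y) \<le> b)"

definition convex_n :: "vec set \<Rightarrow> bool" where
  "convex_n S \<longleftrightarrow> (\<forall>x\<in>S. \<forall>y\<in>S. \<forall>a\<in>{0..1}. comb a x y \<in> S)"

definition convex_fun_on :: "vec set \<Rightarrow> (vec \<Rightarrow> real) \<Rightarrow> bool" where
  "convex_fun_on S f \<longleftrightarrow>
     (\<forall>x\<in>S. \<forall>y\<in>S. \<forall>a\<in>{0..1}. f (comb a x y) \<le> (1 - a) * f x + a * f y)"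

text \<open>Partial derivatives, gradient and Hessian; entry (i, j) of the Hessian is the j-th partial
  derivative of the i-th partial derivative.\<close>

definition partial :: "(vec \<Rightarrow> real) \<Rightarrow> nat \<Rightarrow> vec \<Rightarrow> real" where
  "partial f i x = deriv (\<lambda>t. f (x(i := t))) (x i)"

definition grad :: "nat \<Rightarrow> (vec \<Rightarrow> real) \<Rightarrow> vec \<Rightarrow> vec" where
  "grad n f x = (\<lambda>i. if i < n then partial f i x else 0)"

definition hess :: "nat \<Rightarrow> (vec \<Rightarrow> real) \<Rightarrow> vec \<Rightarrow> nat \<Rightarrow> nat \<Rightarrow> real" where
  "hess n f x = (\<lambda>i j. if i < n \<and> j < n then partial (partial f i) j x else 0)"

definition has_cont_partials :: "nat \<Rightarrow> vec set \<Rightarrow> (vec \<Rightarrow> real) \<Rightarrow> bool" where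
  "has_cont_partials n U f \<longleftrightarrow>
     (\<forall>i<n. (\<forall>x\<in>U. (\<lambda>t. f (x(i := t))) field_differentiable (at (x i))) \<and>
            continuous_map (subtopology (Euclidean_space n) U) euclideanreal (partial f i))"

definition C2_over :: "nat \<Rightarrow> vec set \<Rightarrow> (vec \<Rightarrow> real) \<Rightarrow> bool" where
  "C2_over n S f \<longleftrightarrow>
     (\<exists>U. openin (Euclidean_space n) U \<and> S \<subseteq> U \<and> has_cont_partials n U f \<and>
          (\<forall>i<n. has_cont_partials n U (partial f i)))"


section \<open>The optimization problem\<close>

definition eff_dom :: "nat \<Rightarrow> (vec \<Rightarrow> ereal) \<Rightarrow> vec set" where
  "eff_dom n R = {x \<in> Rn n. R x < \<infinity>}"

definition set_indicator :: "vec set \<Rightarrow> vec \<Rightarrow> ereal" where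
  "set_indicator K x = (if x \<in> K then 0 else \<infinity>)"

definition obj :: "(vec \<Rightarrow> real) \<Rightarrow> (vec \<Rightarrow> ereal) \<Rightarrow> vec \<Rightarrow> ereal" where
  "obj f R x = ereal (f x) + R x"

datatype setting = Assm_A | Assm_B

definition assumption_A ::
  "nat \<Rightarrow> (vec \<Rightarrow> real) \<Rightarrow> (vec \<Rightarrow> ereal) \<Rightarrow> real \<Rightarrow> real \<Rightarrow> vec \<Rightarrow> bool" where
  "assumption_A n f R \<alpha> \<beta> x1 \<longleftrightarrow> 0 < \<alpha> \<and> 0 < \<beta> \<and>
     (\<forall>x\<in>Rn n. obj f R x \<le> obj f R x1 \<longrightarrow>
        (\<forall>v\<in>Rn n. \<alpha> * (norm_n n v)\<^sup>2 \<le> inner_n n v (mat_vec n (hess n f x) v) \<and>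
                   inner_n n v (mat_vec n (hess n f x) v) \<le> \<beta> * (norm_n n v)\<^sup>2))"

definition assumption_B ::
  "nat \<Rightarrow> (vec \<Rightarrow> real) \<Rightarrow> (vec \<Rightarrow> ereal) \<Rightarrow> real \<Rightarrow> real \<Rightarrow> vec \<Rightarrow> bool" where
  "assumption_B n f R \<alpha> \<beta> xs \<longleftrightarrow> 0 < \<alpha> \<and> 0 < \<beta> \<and> bounded_n n (eff_dom n R) \<and>
     (\<forall>x\<in>eff_dom n R. ereal ((norm_n n (vdiff x xs))\<^sup>2)
                     \<le> ereal (2 / \<alpha>) * (obj f R x - (INF u\<in>Rn n. obj f R u))) \<and>
     (\<forall>x\<in>eff_dom n R. \<forall>y\<in>eff_dom n R.
        norm_n n (vdiff (grad n f x) (grad n f y)) \<le> \<beta> * norm_n n (vdiff x y))"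

text \<open>The standing assumptions on f, R, the initialization x1, the current iterate xt and the
  minimizer xs, except that R is proper, closed and convex, which is a property of the indicator
  of a nonempty closed convex set.\<close>

definition problem ::
  "setting \<Rightarrow> nat \<Rightarrow> (vec \<Rightarrow> real) \<Rightarrow> (vec \<Rightarrow> ereal) \<Rightarrow> real \<Rightarrow> real \<Rightarrow> real \<Rightarrow>
   vec \<Rightarrow> vec \<Rightarrow> vec \<Rightarrow> bool" where
  "problem asm n f R \<alpha> \<beta> \<beta>2 x1 xt xs \<longleftrightarrow>
     convex_fun_on (eff_dom n R) f \<and> C2_over n (eff_dom n R) f \<and> 0 \<le> \<beta>2 \<and>
     (\<forall>x\<in>eff_dom n R. \<forall>y\<in>eff_dom n R.
        opnorm n (\<lambda>i j. hess n f x i j - hess n f y i j) \<le> \<beta>2 * norm_n n (vdiff x y)) \<and>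
     (INF u\<in>Rn n. obj f R u) > -\<infinity> \<and>
     {x. is_arg_min (obj f R) (\<lambda>u. u \<in> Rn n) x} = {xs} \<and>
     x1 \<in> eff_dom n R \<and> xt \<in> eff_dom n R \<and> obj f R xt \<le> obj f R x1 \<and>
     (case asm of Assm_A \<Rightarrow> assumption_A n f R \<alpha> \<beta> x1
                | Assm_B \<Rightarrow> assumption_B n f R \<alpha> \<beta> xs)"

definition Q_model :: "setting \<Rightarrow> nat \<Rightarrow> (vec \<Rightarrow> real) \<Rightarrow> real \<Rightarrow> vec \<Rightarrow> vec \<Rightarrow> real" where
  "Q_model asm n f \<beta>2 xt w =
     inner_n n (vdiff w xt) (grad n f xt)
     + inner_n n (vdiff w xt) (mat_vec n (hess n f xt) (vdiff w xt)) / 2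
     + (case asm of Assm_A \<Rightarrow> 0 | Assm_B \<Rightarrow> \<beta>2 / 6 * norm_n n (vdiff w xt) ^ 3)"

definition beta_tilde ::
  "setting \<Rightarrow> nat \<Rightarrow> (vec \<Rightarrow> ereal) \<Rightarrow> real \<Rightarrow> real \<Rightarrow> real" where
  "beta_tilde asm n R \<beta> \<beta>2 =
     (case asm of Assm_A \<Rightarrow> \<beta> | Assm_B \<Rightarrow> \<beta> + \<beta>2 * diameter_n n (eff_dom n R) / 2)"

text \<open>In what follows Q is the smooth model and b its smoothness constant.\<close>

definition psi ::
  "nat \<Rightarrow> (vec \<Rightarrow> real) \<Rightarrow> real \<Rightarrow> (vec \<Rightarrow> ereal) \<Rightarrow> vec \<Rightarrow> real \<Rightarrow> vec \<Rightarrow> ereal" where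
  "psi n Q b R y l z =
     ereal (inner_n n (vdiff z y) (grad n Q y) + l * b / 2 * (norm_n n (vdiff z y))\<^sup>2) + R z"

definition wpo_output ::
  "nat \<Rightarrow> (vec \<Rightarrow> real) \<Rightarrow> real \<Rightarrow> (vec \<Rightarrow> ereal) \<Rightarrow> vec \<Rightarrow> vec \<Rightarrow> real \<Rightarrow> vec \<Rightarrow> bool" where
  "wpo_output n Q b R xs y l w \<longleftrightarrow> w \<in> eff_dom n R \<and>
     psi n Q b R y l w \<le> min (psi n Q b R y l xs) (psi n Q b R y l y)"


section \<open>The sparse weak-proximal step\<close>

datatype symmetry = Nonneg | Sign_Flips

definition perm_closed :: "nat \<Rightarrow> vec set \<Rightarrow> bool" where
  "perm_closed n K \<longleftrightarrow> (\<forall>p x. p permutes {..<n} \<longrightarrow> x \<in> K \<longrightarrow> x \<circ> p \<in> K)"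

definition symmetric_set :: "symmetry \<Rightarrow> nat \<Rightarrow> vec set \<Rightarrow> bool" where
  "symmetric_set kind n K \<longleftrightarrow> perm_closed n K \<and>
     (case kind of
        Nonneg \<Rightarrow> (\<forall>x\<in>K. \<forall>i<n. 0 \<le> x i)
      | Sign_Flips \<Rightarrow> (\<forall>x\<in>K. \<forall>\<sigma>. (\<forall>i. \<sigma> i \<in> {-1, 1}) \<longrightarrow> (\<lambda>i. \<sigma> i * x i) \<in> K))"

text \<open>Restriction to T, the product with the column-deleted identity matrix, and the restricted
  set; the coordinates of a vector indexed by T are those of T in increasing order.\<close>

definition restrict_vec :: "nat set \<Rightarrow> vec \<Rightarrow> vec" where
  "restrict_vec T x = (\<lambda>k. if k < card T then x (sorted_list_of_set T ! k) else 0)"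

definition embed_vec :: "nat set \<Rightarrow> vec \<Rightarrow> vec" where
  "embed_vec T u = (\<lambda>i. \<Sum>k<card T. (if sorted_list_of_set T ! k = i then 1 else 0) * u k)"

definition restrict_set :: "vec set \<Rightarrow> nat set \<Rightarrow> vec set" where
  "restrict_set K T = {u \<in> Rn (card T). embed_vec T u \<in> K}"

definition projection :: "nat \<Rightarrow> vec set \<Rightarrow> vec \<Rightarrow> vec" where
  "projection m S u =
     (SOME v. v \<in> S \<and> (\<forall>v'\<in>S. norm_n m (vdiff u v) \<le> norm_n m (vdiff u v')))"

definition largest_set :: "symmetry \<Rightarrow> nat \<Rightarrow> nat \<Rightarrow> vec \<Rightarrow> nat set \<Rightarrow> bool" where
  "largest_set kind n s z T \<longleftrightarrow> T \<subseteq> {..<n} \<and> card T = s \<and>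
     (\<forall>i\<in>T. \<forall>j\<in>{..<n} - T.
        (case kind of Nonneg \<Rightarrow> z j \<le> z i | Sign_Flips \<Rightarrow> \<bar>z j\<bar> \<le> \<bar>z i\<bar>))"

definition sparse_prox_step ::
  "symmetry \<Rightarrow> nat \<Rightarrow> nat \<Rightarrow> (vec \<Rightarrow> real) \<Rightarrow> real \<Rightarrow> vec set \<Rightarrow> vec \<Rightarrow> real \<Rightarrow> vec \<Rightarrow> bool" where
  "sparse_prox_step kind n s Q b K y l w \<longleftrightarrow>
     (\<exists>z T z'. z = (\<lambda>i. y i - 1 / (l * b) * grad n Q y i) \<and>
        largest_set kind n s z T \<and>
        z' = embed_vec T (projection s (restrict_set K T) (restrict_vec T z)) \<and>
        is_arg_min (psi n Q b (set_indicator K) y l) (\<lambda>u. u \<in> {y, z'}) w)"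


section \<open>A real RAM with oracles\<close>

text \<open>
  A program works on arrays of naturals and arrays of reals; a scalar variable is cell 0 of an
  array. Arithmetic on reals is exact, and square roots are available because the gradient of the
  cubic term involves a norm. Natural-number arithmetic is restricted to addition and truncated
  subtraction, so that the unit-cost convention is harmless.
\<close>

record memory =
  nats :: "string \<Rightarrow> nat \<Rightarrow> nat"
  reals :: "string \<Rightarrow> nat \<Rightarrow> real"

datatype nexp = NConst nat | NCell string nexp | NAdd nexp nexp | NSub nexp nexp

datatype rexp = RConst rat | RCell string nexp | RAdd rexp rexp | RSub rexp rexp
  | RMul rexp rexp | RDiv rexp rexp | RSqrt rexp

datatype bexp = NLess nexp nexp | RLess rexp rexp | BNot bexp | BAnd bexp bexp

primrec nval :: "nexp \<Rightarrow> memory \<Rightarrow> nat" where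
  "nval (NConst k) m = k"
| "nval (NCell a e) m = nats m a (nval e m)"
| "nval (NAdd e1 e2) m = nval e1 m + nval e2 m"
| "nval (NSub e1 e2) m = nval e1 m - nval e2 m"

primrec rval :: "rexp \<Rightarrow> memory \<Rightarrow> real" where
  "rval (RConst q) m = of_rat q"
| "rval (RCell a e) m = reals m a (nval e m)"
| "rval (RAdd e1 e2) m = rval e1 m + rval e2 m"
| "rval (RSub e1 e2) m = rval e1 m - rval e2 m"
| "rval (RMul e1 e2) m = rval e1 m * rval e2 m"
| "rval (RDiv e1 e2) m = rval e1 m / rval e2 m"
| "rval (RSqrt e) m = sqrt (rval e m)"

primrec bval :: "bexp \<Rightarrow> memory \<Rightarrow> bool" where
  "bval (NLess e1 e2) m = (nval e1 m < nval e2 m)"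
| "bval (RLess e1 e2) m = (rval e1 m < rval e2 m)"
| "bval (BNot b) m = (\<not> bval b m)"
| "bval (BAnd b1 b2) m = (bval b1 m \<and> bval b2 m)"

text \<open>
  Project idx len src dst queries the projection oracle: the first len cells of the array idx must
  list a set T of coordinates in increasing order, the first len cells of src are the vector to
  be projected, and the result is written to the first len cells of dst.
  Multiply src dst queries the matrix-product oracle on the first n cells of src and writes the
  result to the first n cells of dst.
\<close>

datatype com = Skip
  | NAssign string nexp nexp
  | RAssign string nexp rexp
  | Seq com com
  | Cond bexp com com
  | While bexp com
  | Project string nexp string string
  | Multiply string string

datatype query = Proj_Query "nat set" vec | Mult_Query vec

definition nat_write :: "string \<Rightarrow> nat \<Rightarrow> nat \<Rightarrow> memory \<Rightarrow> memory" where
  "nat_write a k v m = m\<lparr>nats := (nats m)(a := (nats m a)(k := v))\<rparr>"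

definition real_write :: "string \<Rightarrow> nat \<Rightarrow> real \<Rightarrow> memory \<Rightarrow> memory" where
  "real_write a k v m = m\<lparr>reals := (reals m)(a := (reals m a)(k := v))\<rparr>"

definition block :: "memory \<Rightarrow> string \<Rightarrow> nat \<Rightarrow> vec" where
  "block m a l = (\<lambda>k. if k < l then reals m a k else 0)"

definition block_write :: "string \<Rightarrow> nat \<Rightarrow> vec \<Rightarrow> memory \<Rightarrow> memory" where
  "block_write a l v m =
     m\<lparr>reals := (reals m)(a := (\<lambda>k. if k < l then v k else reals m a k))\<rparr>"

text \<open>
  exec n P H c m t qs m' means that c, started in m, terminates in m' after t steps and has
  issued the oracle queries qs, where P and H are the two oracles. Every assignment, test and
  oracle call is one step: the expressions of a fixed program have constant size.
\<close>

inductive exec ::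
  "nat \<Rightarrow> (nat set \<Rightarrow> vec \<Rightarrow> vec) \<Rightarrow> (vec \<Rightarrow> vec) \<Rightarrow>
   com \<Rightarrow> memory \<Rightarrow> nat \<Rightarrow> query list \<Rightarrow> memory \<Rightarrow> bool"
  for n :: nat and P :: "nat set \<Rightarrow> vec \<Rightarrow> vec" and H :: "vec \<Rightarrow> vec" where
  exec_Skip: "exec n P H Skip m 1 [] m"
| exec_NAssign: "exec n P H (NAssign a i e) m 1 [] (nat_write a (nval i m) (nval e m) m)"
| exec_RAssign: "exec n P H (RAssign a i e) m 1 [] (real_write a (nval i m) (rval e m) m)"
| exec_Seq: "exec n P H c1 m t1 q1 m1 \<Longrightarrow> exec n P H c2 m1 t2 q2 m2 \<Longrightarrow>
    exec n P H (Seq c1 c2) m (t1 + t2) (q1 @ q2) m2"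
| exec_CondTrue: "bval b m \<Longrightarrow> exec n P H c1 m t q m' \<Longrightarrow> exec n P H (Cond b c1 c2) m (t + 1) q m'"
| exec_CondFalse: "\<not> bval b m \<Longrightarrow> exec n P H c2 m t q m' \<Longrightarrow> exec n P H (Cond b c1 c2) m (t + 1) q m'"
| exec_WhileFalse: "\<not> bval b m \<Longrightarrow> exec n P H (While b c) m 1 [] m"
| exec_WhileTrue: "bval b m \<Longrightarrow> exec n P H c m t1 q1 m1 \<Longrightarrow>
    exec n P H (While b c) m1 t2 q2 m2 \<Longrightarrow>
    exec n P H (While b c) m (t1 + t2 + 1) (q1 @ q2) m2"
| exec_Project: "l = nval len m \<Longrightarrow> ts = map (nats m idx) [0..<l] \<Longrightarrow>
    sorted_wrt (<) ts \<Longrightarrow> set ts \<subseteq> {..<n} \<Longrightarrow> u = block m src l \<Longrightarrow>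
    exec n P H (Project idx len src dst) m 1 [Proj_Query (set ts) u]
      (block_write dst l (P (set ts) u) m)"
| exec_Multiply: "v = block m src n \<Longrightarrow>
    exec n P H (Multiply src dst) m 1 [Mult_Query v] (block_write dst n (H v) m)"

definition proj_queries :: "query list \<Rightarrow> (nat set \<times> vec) list" where
  "proj_queries qs = concat (map (\<lambda>q. case q of Proj_Query T u \<Rightarrow> [(T, u)] | Mult_Query v \<Rightarrow> []) qs)"

definition mult_queries :: "query list \<Rightarrow> vec list" where
  "mult_queries qs = concat (map (\<lambda>q. case q of Proj_Query T u \<Rightarrow> [] | Mult_Query v \<Rightarrow> [v]) qs)"


section \<open>Implementations of the algorithm\<close>

text \<open>Besides the initial information (arrays x, g, h) the program knows the dimension, the
  sparsity and the two constants of the model, and finds the current step size in lambda.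
  All other cells are 0 initially.\<close>

definition initial_memory ::
  "nat \<Rightarrow> nat \<Rightarrow> real \<Rightarrow> real \<Rightarrow> vec \<Rightarrow> vec \<Rightarrow> vec \<Rightarrow> memory" where
  "initial_memory n s b \<beta>2 xt g h =
     \<lparr>nats = (\<lambda>_ _. 0)(''n'' := (\<lambda>_. 0)(0 := n), ''s'' := (\<lambda>_. 0)(0 := s)),
      reals = (\<lambda>_ _. 0)(''btilde'' := (\<lambda>_. 0)(0 := b), ''beta2'' := (\<lambda>_. 0)(0 := \<beta>2),
                        ''x'' := xt, ''g'' := g, ''h'' := h)\<rparr>"

text \<open>
  One pass of prog, with step size a, takes memory m and iterate y to memory m' and iterate y'
  within the claimed resources, and computes the next iterate of the algorithm.
  The sparse step divides by a; for a = 0 the next iterate is y whatever the oracle answers.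
  The logarithm is replaced by 1 when s = 1.
\<close>

definition implements_iteration ::
  "com \<Rightarrow> real \<Rightarrow> symmetry \<Rightarrow> nat \<Rightarrow> nat \<Rightarrow> (vec \<Rightarrow> real) \<Rightarrow> real \<Rightarrow> vec set \<Rightarrow> vec \<Rightarrow>
   (nat \<Rightarrow> nat \<Rightarrow> real) \<Rightarrow> real \<Rightarrow> memory \<Rightarrow> vec \<Rightarrow> memory \<Rightarrow> vec \<Rightarrow> bool" where
  "implements_iteration prog C kind n s Q b K xs A a m y m' y' \<longleftrightarrow>
     (\<exists>t qs w.
        exec n (\<lambda>T. projection (card T) (restrict_set K T)) (mat_vec n A)
          prog (real_write ''lambda'' 0 a m) t qs m' \<and>
        wpo_output n Q b (set_indicator K) xs y a w \<and>
        (0 < a \<longrightarrow> sparse_prox_step kind n s Q b K y a w \<and> block m' ''w'' n = w) \<and>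
        y' = comb a y w \<and> block m' ''y'' n = y' \<and>
        length (proj_queries qs) \<le> 1 \<and> (\<forall>(T, u)\<in>set (proj_queries qs). card T = s) \<and>
        length (mult_queries qs) \<le> 1 \<and> (\<forall>v\<in>set (mult_queries qs). nnz n v \<le> s) \<and>
        real t \<le> C * (real n * max 1 (log 2 (real s))))"

end

theory Submission
  imports Defs
begin

text \<open>
  Swapping two coordinates, with a sign change if necessary, moves the support of any \<open>s\<close>-sparse point
  of \<open>K\<close> into a set \<open>T\<close> of \<open>s\<close> largest entries of \<open>z\<close> without increasing its distance to \<open>z\<close>. So
  the projection of \<open>z\<close> restricted to \<open>K\<^sub>T\<close> is at least as close to \<open>z\<close> as the minimizer, and as
  \<open>\<psi>\<close> is on \<open>K\<close> a multiple of the squared distance to \<open>z\<close> plus a constant, the step answers the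
  weak proximal oracle.

  The set \<open>T\<close> is found in time \<open>O(n log s)\<close> by a min-heap of size \<open>s\<close>: an entry larger than the
  root replaces it and sifts down. The gradient of the model at \<open>y\<close> needs the product of the Hessian with
  \<open>y - x\<^sub>t\<close>. It is kept up to date from the product with the sparse vector \<open>z'\<close>, since the next iterate
  is a convex combination of \<open>y\<close> with \<open>z'\<close> or with \<open>y\<close> itself.
\<close>

section \<open>Sparse projections onto symmetric sets\<close>

text \<open>The Hessian product with \<open>y - xt\<close> obeys a linear recursion in which only
  the product with \<open>z'\<close> is new. The product with \<open>xt\<close>, given as initial
  information, is exactly the term that this recursion subtracts. Since the subproblem has value 0
  at \<open>y\<close>, choosing between \<open>y\<close> and \<open>z'\<close> takes one sum over
  the coordinates. Differentiating the quadratic part of the model gives the product with the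
  Hessian only if the Hessian is symmetric. Its definition by iterated partial derivatives does not
  contain this, so Schwarz's theorem is proved for planes spanned by two coordinates. The projection
  oracle wants its indices in increasing order, which a heap does not provide; a linear marking pass
  restores it without sorting. The step divides by the step size, so step size 0 is a separate
  branch. The logarithm enters only through the depth of the heap. All other work consists of a
  fixed number of passes over at most \<open>n\<close> cells.\<close>

lemma in_Rn_iff: "x \<in> Rn n \<longleftrightarrow> (\<forall>i\<ge>n. x i = 0)"
  by (auto simp: topspace_Euclidean_space)

lemma norm_n_power2: "(norm_n n x)\<^sup>2 = (\<Sum>i<n. (x i)\<^sup>2)"
  by (simp add: norm_n_def L2_set_def sum_nonneg)

lemma norm_n_nonneg: "0 \<le> norm_n n x"
  by (simp add: norm_n_def)

lemma norm_n_le_iff: "norm_n n x \<le> norm_n m y \<longleftrightarrow> (\<Sum>i<n. (x i)\<^sup>2) \<le> (\<Sum>i<m. (y i)\<^sup>2)"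
  by (simp add: norm_n_def L2_set_def)

text \<open>\<open>projection\<close> is a choice operator, so it is meaningful only once a nearest
  point is known to exist. Points of \<open>S\<close> at least as close as some fixed
  \<open>v0\<close> lie in a compact box, and the distance attains its minimum on the part of
  \<open>S\<close> inside that box.\<close>

lemma projection_nearest:
  assumes "closedin (Euclidean_space m) S" "S \<noteq> {}"
  shows "projection m S u \<in> S \<and> (\<forall>v\<in>S. norm_n m (vdiff u (projection m S u)) \<le> norm_n m (vdiff u v))"
proof -
  obtain v0 where v0: "v0 \<in> S" using assms(2) by blast
  have SR: "S \<subseteq> Rn m" using assms(1) by (rule closedin_subset)
  define r where "r = norm_n m (vdiff u v0)"
  \<comment> \<open>Compactness is taken in the product topology on all functions; the factor {0}
    from index \<open>m\<close> on reflects that points of \<open>S\<close> vanish there.\<close>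
  define B where "B = (\<lambda>i. if i < m then {u i - r..u i + r} else {0})"
  have "compactin (product_topology (\<lambda>_. euclideanreal) UNIV) (PiE UNIV B)"
    unfolding compactin_PiE by (auto simp: B_def)
  then have "compact (PiE UNIV B)"
    by (simp add: euclidean_product_topology)
  moreover have "closed S"
    using assms(1) by (rule closedin_Euclidean_imp_closed)
  ultimately have "compact (PiE UNIV B \<inter> S)" by blast
  moreover have in_box: "v \<in> PiE UNIV B" if v: "v \<in> S" "norm_n m (vdiff u v) \<le> r" for v
  proof -
    have "\<bar>u i - v i\<bar> \<le> r" if "i < m" for i
      using member_le_L2_set[of "{..<m}" i "\<lambda>i. \<bar>vdiff u v i\<bar>"] v(2) that
      by (simp add: norm_n_def vdiff_def L2_set_def)
    moreover have "v i = 0" if "\<not> i < m" for i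
      using SR v(1) that by (auto simp: in_Rn_iff)
    ultimately show ?thesis by (fastforce simp: B_def abs_le_iff)
  qed
  moreover have "v0 \<in> PiE UNIV B \<inter> S" using in_box[of v0] v0 by (simp add: r_def)
  moreover have "continuous_on (PiE UNIV B \<inter> S) (\<lambda>v. norm_n m (vdiff u v))"
    unfolding norm_n_def L2_set_def vdiff_def
    by (intro continuous_intros continuous_on_subset[OF continuous_on_product_coordinates]) auto
  ultimately obtain v where v: "v \<in> PiE UNIV B \<inter> S"
    and min: "\<And>v'. v' \<in> PiE UNIV B \<inter> S \<Longrightarrow> norm_n m (vdiff u v) \<le> norm_n m (vdiff u v')"
    using continuous_attains_inf[of "PiE UNIV B \<inter> S" "\<lambda>v. norm_n m (vdiff u v)"] by blast
  have "norm_n m (vdiff u v) \<le> norm_n m (vdiff u v')" if "v' \<in> S" for v'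
  proof (cases "norm_n m (vdiff u v') \<le> r")
    case True then show ?thesis using in_box min that by blast
  next
    case False
    moreover have "norm_n m (vdiff u v) \<le> r"
      using min[of v0] in_box[of v0] v0 by (simp add: r_def)
    ultimately show ?thesis by linarith
  qed
  then have "\<exists>v. v \<in> S \<and> (\<forall>v'\<in>S. norm_n m (vdiff u v) \<le> norm_n m (vdiff u v'))"
    using v by blast
  from someI_ex[OF this] show ?thesis unfolding projection_def by blast
qed

section \<open>Restriction to a set of coordinates and its embedding\<close>

lemma embed_vec_nth:
  assumes "finite T" "k < card T"
  shows "embed_vec T u (sorted_list_of_set T ! k) = u k"
proof -
  have "(\<Sum>j<card T. (if sorted_list_of_set T ! j = sorted_list_of_set T ! k then 1 else 0) * u j)
      = (\<Sum>j<card T. (if j = k then u j else 0))"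
    using assms by (intro sum.cong) (auto simp: nth_eq_iff_index_eq)
  then show ?thesis using assms(2) by (simp add: embed_vec_def)
qed

lemma embed_vec_outside:
  assumes "finite T" "i \<notin> T"
  shows "embed_vec T u i = 0"
proof -
  have "sorted_list_of_set T ! k \<noteq> i" if "k < card T" for k
    using assms that nth_mem[of k "sorted_list_of_set T"] by auto
  then show ?thesis by (simp add: embed_vec_def)
qed

lemma embed_restrict_vec:
  assumes "finite T" "\<And>i. i \<notin> T \<Longrightarrow> x i = 0"
  shows "embed_vec T (restrict_vec T x) = x"
proof
  fix i
  show "embed_vec T (restrict_vec T x) i = x i"
  proof (cases "i \<in> T")
    case True
    then obtain k where "k < card T" "i = sorted_list_of_set T ! k"
      using assms(1) by (metis in_set_conv_nth length_sorted_list_of_set set_sorted_list_of_set)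
    then show ?thesis using assms(1) by (simp add: embed_vec_nth restrict_vec_def)
  qed (simp add: embed_vec_outside assms)
qed

lemma sum_sorted_list_of_set:
  fixes g :: "nat \<Rightarrow> 'a::comm_monoid_add"
  assumes "finite T"
  shows "(\<Sum>k<card T. g (sorted_list_of_set T ! k)) = (\<Sum>i\<in>T. g i)"
proof -
  have "bij_betw ((!) (sorted_list_of_set T)) {..<card T} T"
    using assms by (intro bij_betw_nth) auto
  then show ?thesis by (simp add: sum.reindex_bij_betw)
qed

text \<open>Pythagoras: the coordinates outside \<open>T\<close> contribute an amount independent of
  \<open>v\<close>. Hence minimizing the distance to \<open>z\<close> over vectors supported in
  \<open>T\<close> is a projection problem in dimension \<open>card T\<close>.\<close>

lemma norm_embed_vec:
  assumes "T \<subseteq> {..<n}"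
  shows "(norm_n n (vdiff (embed_vec T v) z))\<^sup>2
    = (norm_n (card T) (vdiff (restrict_vec T z) v))\<^sup>2 + (\<Sum>i\<in>{..<n} - T. (z i)\<^sup>2)"
proof -
  have fin: "finite T" using assms finite_subset by blast
  have "(norm_n n (vdiff (embed_vec T v) z))\<^sup>2
      = (\<Sum>i\<in>T. (embed_vec T v i - z i)\<^sup>2) + (\<Sum>i\<in>{..<n} - T. (embed_vec T v i - z i)\<^sup>2)"
    unfolding norm_n_power2 vdiff_def using assms
    by (simp add: sum.subset_diff[of T "{..<n}"] add.commute)
  also have "(\<Sum>i\<in>T. (embed_vec T v i - z i)\<^sup>2)
      = (\<Sum>k<card T. (v k - z (sorted_list_of_set T ! k))\<^sup>2)"
    unfolding sum_sorted_list_of_set[OF fin, symmetric]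
    by (simp add: embed_vec_nth[OF fin])
  also have "\<dots> = (norm_n (card T) (vdiff (restrict_vec T z) v))\<^sup>2"
    unfolding norm_n_power2 vdiff_def by (simp add: restrict_vec_def power2_commute)
  finally show ?thesis using fin by (simp add: embed_vec_outside)
qed

text \<open>\<open>embed_vec T\<close> is continuous, so the condition defining the restricted set
  is the preimage of a closed set.\<close>

lemma closedin_restrict_set:
  assumes "closedin (Euclidean_space n) K"
  shows "closedin (Euclidean_space (card T)) (restrict_set K T)"
proof -
  have "closed K" using assms by (rule closedin_Euclidean_imp_closed)
  moreover have "continuous_on UNIV (embed_vec T)"
    unfolding embed_vec_def
    by (intro continuous_on_coordinatewise_then_product continuous_intros continuous_on_product_coordinates)
  ultimately have "closed (embed_vec T -` K)"
    by (simp add: continuous_closed_vimage continuous_on_eq_continuous_at)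
  moreover have "restrict_set K T = Rn (card T) \<inter> embed_vec T -` K"
    by (auto simp: restrict_set_def)
  ultimately show ?thesis
    unfolding closedin_Euclidean_space_iff
    using closedin_topspace[of "Euclidean_space (card T)"] closedin_Euclidean_imp_closed
    by (metis closed_Int inf_le1)
qed

text \<open>Moving a nonzero entry from a coordinate with a small entry of \<open>z\<close> to a free coordinate with
  a large one (with the sign of \<open>z\<close> there, when sign flips are allowed) keeps the norm and does not
  decrease the inner product with \<open>z\<close>.\<close>

lemma symmetric_set_move:
  assumes sym: "symmetric_set kind n K" and x: "x \<in> K" and ij: "i < n" "j < n" "i \<noteq> j"
    and xi: "x i = 0"
    and z: "case kind of Nonneg \<Rightarrow> z j \<le> z i | Sign_Flips \<Rightarrow> \<bar>z j\<bar> \<le> \<bar>z i\<bar>"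
  shows "\<exists>v. \<bar>v\<bar> = \<bar>x j\<bar> \<and> x j * z j \<le> v * z i \<and> x(i := v, j := 0) \<in> K"
proof -
  have "x \<circ> Transposition.transpose i j \<in> K"
    using sym x ij unfolding symmetric_set_def perm_closed_def
    by (meson lessThan_iff permutes_swap_id)
  moreover have "x \<circ> Transposition.transpose i j = x(i := x j, j := 0)"
    using xi ij by (auto simp: Transposition.transpose_def fun_eq_iff)
  ultimately have sw: "x(i := x j, j := 0) \<in> K" by simp
  show ?thesis
  proof (cases kind)
    case Nonneg
    then have "0 \<le> x j" using sym x ij by (auto simp: symmetric_set_def)
    then have "x j * z j \<le> x j * z i" using z Nonneg by (intro mult_left_mono) auto
    then show ?thesis using sw by blast
  next
    case Sign_Flips
    \<comment> \<open>The sign makes \<open>e * x j * z i\<close> the product of the absolute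
      values, so that the comparison of absolute values of \<open>z\<close> applies.\<close>
    define e :: real where "e = (if 0 \<le> x j * z i then 1 else -1)"
    have "(\<lambda>k. (if k = i then e else 1) * (x(i := x j, j := 0)) k) \<in> K"
      using sym sw Sign_Flips unfolding symmetric_set_def
      by (auto simp: e_def)
    moreover have "(\<lambda>k. (if k = i then e else 1) * (x(i := x j, j := 0)) k) = x(i := e * x j, j := 0)"
      using ij by (auto simp: fun_eq_iff)
    moreover have "\<bar>e * x j\<bar> = \<bar>x j\<bar>" by (simp add: e_def)
    moreover have "x j * z j \<le> e * x j * z i"
    proof -
      have "x j * z j \<le> \<bar>x j\<bar> * \<bar>z j\<bar>" by (metis abs_ge_self abs_mult)
      also have "\<dots> \<le> \<bar>x j\<bar> * \<bar>z i\<bar>" using z Sign_Flips by (intro mult_left_mono) auto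
      also have "\<dots> = e * x j * z i" by (simp add: e_def flip: abs_mult)
      finally show ?thesis .
    qed
    ultimately show ?thesis by metis
  qed
qed

text \<open>Induction on the number of nonzero entries outside \<open>T\<close>: as long as there is
  one, sparsity leaves a zero entry inside \<open>T\<close> to which it can be moved.\<close>

lemma exists_supported_nearer:
  assumes sym: "symmetric_set kind n K" and KR: "K \<subseteq> Rn n" and T: "largest_set kind n s z T"
    and x: "x \<in> K" "nnz n x \<le> s"
  shows "\<exists>x'\<in>K. (\<forall>i. i \<notin> T \<longrightarrow> x' i = 0) \<and> norm_n n (vdiff x' z) \<le> norm_n n (vdiff x z)"
  using x
proof (induction "card {i. i < n \<and> i \<notin> T \<and> x i \<noteq> 0}" arbitrary: x rule: less_induct)
  case less
  have Tn: "T \<subseteq> {..<n}" and cT: "card T = s" using T by (auto simp: largest_set_def)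
  show ?case
  proof (cases "\<exists>j<n. j \<notin> T \<and> x j \<noteq> 0")
    case False
    then have "x i = 0" if "i \<notin> T" for i
      using that less.prems(1) KR by (cases "i < n") (auto simp: in_Rn_iff subset_iff)
    then show ?thesis using less.prems by blast
  next
    case True
    then obtain j where j: "j < n" "j \<notin> T" "x j \<noteq> 0" by blast
    \<comment> \<open>Otherwise all of \<open>T\<close> together with \<open>j\<close> would give s
      + 1 nonzero entries.\<close>
    have "\<exists>i\<in>T. x i = 0"
    proof (rule ccontr)
      assume "\<not> (\<exists>i\<in>T. x i = 0)"
      then have "insert j T \<subseteq> {i. i < n \<and> x i \<noteq> 0}" using j Tn by auto
      then have "card (insert j T) \<le> nnz n x" unfolding nnz_def by (intro card_mono) auto
      then show False using less.prems j cT finite_subset[OF Tn] by simp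
    qed
    then obtain i where i: "i \<in> T" "x i = 0" by blast
    have ij: "i < n" "i \<noteq> j" using i j Tn by auto
    have "case kind of Nonneg \<Rightarrow> z j \<le> z i | Sign_Flips \<Rightarrow> \<bar>z j\<bar> \<le> \<bar>z i\<bar>"
      using T i j by (auto simp: largest_set_def)
    from symmetric_set_move[OF sym less.prems(1) ij(1) j(1) ij(2) i(2) this]
    obtain v where v: "\<bar>v\<bar> = \<bar>x j\<bar>" "x j * z j \<le> v * z i" and K: "x(i := v, j := 0) \<in> K" by blast
    define x1 where "x1 = x(i := v, j := 0)"
    have v0: "v \<noteq> 0" using v j by auto
    have "{k. k < n \<and> k \<notin> T \<and> x1 k \<noteq> 0} \<subset> {k. k < n \<and> k \<notin> T \<and> x k \<noteq> 0}"
      using j i by (auto simp: x1_def)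
    then have "card {k. k < n \<and> k \<notin> T \<and> x1 k \<noteq> 0} < card {k. k < n \<and> k \<notin> T \<and> x k \<noteq> 0}"
      by (intro psubset_card_mono) auto
    moreover have "nnz n x1 \<le> s"
    proof -
      have "{k. k < n \<and> x1 k \<noteq> 0} = insert i ({k. k < n \<and> x k \<noteq> 0} - {j})"
        using i j ij v0 by (auto simp: x1_def)
      then have "nnz n x1 = Suc (card ({k. k < n \<and> x k \<noteq> 0} - {j}))"
        unfolding nnz_def using i by simp
      also have "\<dots> = nnz n x" unfolding nnz_def using j by (intro card_Suc_Diff1) auto
      finally show ?thesis using less.prems by simp
    qed
    ultimately obtain x' where x': "x' \<in> K" "\<forall>i. i \<notin> T \<longrightarrow> x' i = 0"
      "norm_n n (vdiff x' z) \<le> norm_n n (vdiff x1 z)"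
      using less.hyps[of x1] K x1_def by blast
    have split: "sum g {..<n} = g i + (g j + sum g ({..<n} - {i} - {j}))" for g :: "nat \<Rightarrow> real"
      using ij j by (subst sum.remove[of _ i], simp, simp, subst sum.remove[of _ j]) auto
    \<comment> \<open>After expansion the squares at \<open>i\<close> and \<open>j\<close> agree in
      total; only the cross terms differ, and \<open>x j * z j \<le> v * z i\<close> compares
      them.\<close>
    have "v\<^sup>2 = (x j)\<^sup>2" using v(1) by (simp add: power2_eq_iff abs_eq_iff)
    then have "(\<Sum>k<n. (x1 k - z k)\<^sup>2) \<le> (\<Sum>k<n. (x k - z k)\<^sup>2)"
      unfolding split using v(2) i ij by (simp add: x1_def power2_diff)
    then have "norm_n n (vdiff x1 z) \<le> norm_n n (vdiff x z)"
      by (simp add: norm_n_le_iff vdiff_def)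
    then show ?thesis using x' by (meson order_trans)
  qed
qed

text \<open>The point \<open>x'\<close> supported in \<open>T\<close> is the embedding of its own
  restriction, which makes that restriction a competitor in the low-dimensional projection. It also
  shows that the restricted set is nonempty.\<close>

lemma sparse_projection_nearest:
  assumes sym: "symmetric_set kind n K" and cl: "closedin (Euclidean_space n) K"
    and T: "largest_set kind n s z T" and x: "x \<in> K" "nnz n x \<le> s"
  defines "z' \<equiv> embed_vec T (projection s (restrict_set K T) (restrict_vec T z))"
  shows "z' \<in> K" and "norm_n n (vdiff z' z) \<le> norm_n n (vdiff x z)"
proof -
  have KR: "K \<subseteq> Rn n" using cl by (rule closedin_subset)
  have Tn: "T \<subseteq> {..<n}" and cT: "card T = s" using T by (auto simp: largest_set_def)
  have fin: "finite T" using Tn finite_subset by blast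
  obtain x' where x': "x' \<in> K" "\<And>i. i \<notin> T \<Longrightarrow> x' i = 0"
    "norm_n n (vdiff x' z) \<le> norm_n n (vdiff x z)"
    using exists_supported_nearer[OF sym KR T x] by blast
  have emb: "embed_vec T (restrict_vec T x') = x'"
    using fin x'(2) by (rule embed_restrict_vec)
  then have mem: "restrict_vec T x' \<in> restrict_set K T"
    using x'(1) by (simp add: restrict_set_def in_Rn_iff restrict_vec_def)
  let ?p = "projection s (restrict_set K T) (restrict_vec T z)"
  have p: "?p \<in> restrict_set K T"
    "norm_n s (vdiff (restrict_vec T z) ?p) \<le> norm_n s (vdiff (restrict_vec T z) (restrict_vec T x'))"
    using projection_nearest[of s "restrict_set K T"] closedin_restrict_set[OF cl, of T] mem cT
    by auto
  show "z' \<in> K" using p(1) by (simp add: z'_def restrict_set_def)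
  have "(norm_n n (vdiff z' z))\<^sup>2 \<le> (norm_n n (vdiff (embed_vec T (restrict_vec T x')) z))\<^sup>2"
    unfolding z'_def norm_embed_vec[OF Tn] cT using p(2) by (simp add: power_mono norm_n_nonneg)
  then show "norm_n n (vdiff z' z) \<le> norm_n n (vdiff x z)"
    using x'(3) unfolding emb by (meson norm_n_nonneg order_trans power2_le_imp_le)
qed

section \<open>The gradient of the model\<close>

lemma mixed_difference_mean_value:
  fixes F Fx Fxy :: "real \<Rightarrow> real \<Rightarrow> real"
  assumes h: "0 < h"
    and Fx: "\<And>s t. \<lbrakk>a \<le> s; s \<le> a + h; b \<le> t; t \<le> b + h\<rbrakk>
                \<Longrightarrow> ((\<lambda>s. F s t) has_real_derivative Fx s t) (at s)"
    and Fxy: "\<And>s t. \<lbrakk>a \<le> s; s \<le> a + h; b \<le> t; t \<le> b + h\<rbrakk>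
                \<Longrightarrow> ((\<lambda>t. Fx s t) has_real_derivative Fxy s t) (at t)"
  shows "\<exists>s t. a < s \<and> s < a + h \<and> b < t \<and> t < b + h \<and>
     F (a + h) (b + h) - F (a + h) b - F a (b + h) + F a b = h * h * Fxy s t"
proof -
  \<comment> \<open>The mean value theorem is applied in the first variable to the difference of
    \<open>F\<close> at the two heights \<open>b + h\<close> and \<open>b\<close>, and afterwards in
    the second variable to \<open>Fx s\<close>.\<close>
  have "\<exists>s>a. s < a + h \<and> (F (a + h) (b + h) - F (a + h) b) - (F a (b + h) - F a b)
      = (a + h - a) * (Fx s (b + h) - Fx s b)"
    using h by (intro MVT2) (auto intro!: DERIV_diff Fx)
  then obtain s where s: "a < s" "s < a + h"
    "(F (a + h) (b + h) - F (a + h) b) - (F a (b + h) - F a b) = h * (Fx s (b + h) - Fx s b)"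
    by auto
  have "\<exists>t>b. t < b + h \<and> Fx s (b + h) - Fx s b = (b + h - b) * Fxy s t"
    using h s by (intro MVT2) (auto intro!: Fxy)
  then obtain t where t: "b < t" "t < b + h" "Fx s (b + h) - Fx s b = h * Fxy s t" by auto
  have "F (a + h) (b + h) - F (a + h) b - F a (b + h) + F a b = h * h * Fxy s t"
    using s(3) unfolding t(3) by simp
  then show ?thesis using s t by blast
qed

text \<open>Schwarz's theorem. The second difference over a square does not depend on the order of
  the variables, so some value of \<open>Fxy\<close> equals some value of \<open>Fyx\<close> in
  every small square at the point. Continuity excludes this if the two differ at the point
  itself.\<close>

lemma mixed_partials_commute:
  fixes F Fx Fy Fxy Fyx :: "real \<Rightarrow> real \<Rightarrow> real"
  assumes U: "open U" "(a, b) \<in> U"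
    and Fx: "\<And>s t. (s, t) \<in> U \<Longrightarrow> ((\<lambda>s. F s t) has_real_derivative Fx s t) (at s)"
    and Fy: "\<And>s t. (s, t) \<in> U \<Longrightarrow> ((\<lambda>t. F s t) has_real_derivative Fy s t) (at t)"
    and Fxy: "\<And>s t. (s, t) \<in> U \<Longrightarrow> ((\<lambda>t. Fx s t) has_real_derivative Fxy s t) (at t)"
    and Fyx: "\<And>s t. (s, t) \<in> U \<Longrightarrow> ((\<lambda>s. Fy s t) has_real_derivative Fyx s t) (at s)"
    and cont: "continuous_on U (\<lambda>(s, t). Fxy s t)" "continuous_on U (\<lambda>(s, t). Fyx s t)"
  shows "Fxy a b = Fyx a b"
proof (rule ccontr)
  assume ne: "Fxy a b \<noteq> Fyx a b"
  define e where "e = \<bar>Fxy a b - Fyx a b\<bar> / 2"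
  have e: "0 < e" using ne by (simp add: e_def)
  have lim: "((\<lambda>(s, t). Fxy s t) \<longlongrightarrow> Fxy a b) (nhds (a, b))"
    "((\<lambda>(s, t). Fyx s t) \<longlongrightarrow> Fyx a b) (nhds (a, b))"
    using cont U by (auto simp: continuous_on_eq_continuous_at isCont_def tendsto_at_iff_tendsto_nhds)
  have "\<forall>\<^sub>F p in nhds (a, b). p \<in> U \<and> dist (case p of (s, t) \<Rightarrow> Fxy s t) (Fxy a b) < e
      \<and> dist (case p of (s, t) \<Rightarrow> Fyx s t) (Fyx a b) < e"
    by (intro eventually_conj eventually_nhds_in_open U tendstoD lim e)
  then obtain r where r: "0 < r"
    and near: "\<And>p. dist p (a, b) < r \<Longrightarrow> p \<in> U \<and> dist (case p of (s, t) \<Rightarrow> Fxy s t) (Fxy a b) < e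
      \<and> dist (case p of (s, t) \<Rightarrow> Fyx s t) (Fyx a b) < e"
    unfolding eventually_nhds_metric by blast
  \<comment> \<open>With side r / 3 every point of the square has coordinate distances summing to at
    most 2 r / 3, which stays inside the ball of radius \<open>r\<close>.\<close>
  define h where "h = r / 3"
  have h: "0 < h" using r by (simp add: h_def)
  have box: "dist (s, t) (a, b) < r" if "a \<le> s" "s \<le> a + h" "b \<le> t" "t \<le> b + h" for s t
  proof -
    have "dist (s, t) (a, b) \<le> \<bar>s - a\<bar> + \<bar>t - b\<bar>"
      unfolding dist_Pair_Pair dist_real_def using sqrt_sum_squares_le_sum_abs[of "s - a" "t - b"] by simp
    then show ?thesis using that r by (simp add: h_def)
  qed
  obtain s t where st: "a < s" "s < a + h" "b < t" "t < b + h"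
    "F (a + h) (b + h) - F (a + h) b - F a (b + h) + F a b = h * h * Fxy s t"
    using mixed_difference_mean_value[OF h, of a b F Fx Fxy] Fx Fxy near box by blast
  obtain t' s' where st': "b < t'" "t' < b + h" "a < s'" "s' < a + h"
    "F (a + h) (b + h) - F a (b + h) - F (a + h) b + F a b = h * h * Fyx s' t'"
    using mixed_difference_mean_value[OF h, of b a "\<lambda>t s. F s t" "\<lambda>t s. Fy s t" "\<lambda>t s. Fyx s t"]
      Fy Fyx near box by blast
  have "h * h * Fxy s t = h * h * Fyx s' t'" using st(5) st'(5) by linarith
  then have eq: "Fxy s t = Fyx s' t'" using h by simp
  have "dist (Fxy s t) (Fxy a b) < e" "dist (Fyx s' t') (Fyx a b) < e"
    using near[of "(s, t)"] near[of "(s', t')"] box[of s t] box[of s' t'] st st' by auto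
  then have "\<bar>Fxy a b - Fyx a b\<bar> < 2 * e" using eq unfolding dist_real_def by linarith
  then show False by (simp add: e_def)
qed

text \<open>Freezing all coordinates except \<open>i\<close> and \<open>j\<close> embeds a plane
  through \<open>x\<close>. The open neighbourhood of \<open>S\<close> pulls back to an open set of
  the plane, where the two-variable theorem applies.\<close>

lemma hess_symmetric:
  assumes C2: "C2_over n S f" and x: "x \<in> S" "x \<in> Rn n"
  shows "hess n f x i j = hess n f x j i"
proof (cases "i < n \<and> j < n \<and> i \<noteq> j")
  case True
  then have ij: "i < n" "j < n" "i \<noteq> j" by auto
  obtain U where U: "openin (Euclidean_space n) U" "S \<subseteq> U" "has_cont_partials n U f"
    "\<And>i. i < n \<Longrightarrow> has_cont_partials n U (partial f i)"
    using C2 unfolding C2_over_def by blast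
  define g where "g = (\<lambda>(s, t). x(i := s, j := t))"
  have cg: "continuous_on A g" for A
  proof -
    have "continuous_on A (\<lambda>p. g p k)" for k
      unfolding g_def
      by (cases "k = j"; cases "k = i")
        (simp_all add: case_prod_beta continuous_on_fst continuous_on_snd continuous_on_id)
    then show ?thesis by (rule continuous_on_coordinatewise_then_product)
  qed
  have gR: "g p \<in> Rn n" for p using x(2) ij by (auto simp: g_def in_Rn_iff split: prod.split)
  \<comment> \<open>This identification moves between the abstract topology of the definitions and
    the type-class notions \<open>open\<close> and \<open>continuous_on\<close>.\<close>
  have E: "Euclidean_space n = top_of_set {x. \<forall>i\<ge>n. x i = 0}"
    unfolding Euclidean_space_def euclidean_product_topology by (rule refl)
  define V where "V = g -` U"
  have "continuous_map euclidean (Euclidean_space n) g"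
    unfolding E continuous_map_in_subtopology using cg[of UNIV] gR by (simp add: in_Rn_iff image_subset_iff)
  then have "openin euclidean {p \<in> topspace euclidean. g p \<in> U}"
    using U(1) by (rule openin_continuous_map_preimage)
  then have V: "open V" by (simp add: V_def vimage_def)
  have UR: "U \<subseteq> Rn n" using U(1) by (rule openin_subset)
  have "subtopology (Euclidean_space n) U = top_of_set U"
    unfolding E using UR
    by (simp add: subtopology_subtopology Int_absorb1 topspace_Euclidean_space)
  then have cp: "continuous_on U (partial (partial f k) l)" if "k < n" "l < n" for k l
    using U(4)[OF that(1)] that(2) by (simp add: has_cont_partials_def)
  have cpg: "continuous_on V (\<lambda>(s, t). partial (partial f k) l (g (s, t)))" if "k < n" "l < n" for k l
  proof -
    have "continuous_on V (partial (partial f k) l \<circ> g)"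
      by (rule continuous_on_compose[OF cg]) (auto intro: continuous_on_subset[OF cp[OF that]] simp: V_def)
    then show ?thesis by (simp add: o_def)
  qed
  have di: "((\<lambda>s. q (g (s, t))) has_real_derivative partial q i (g (s, t))) (at s)"
    if "has_cont_partials n U q" "(s, t) \<in> V" for q s t
  proof -
    have "(\<lambda>u. q ((g (s, t))(i := u))) field_differentiable at (g (s, t) i)"
      using that ij by (auto simp: has_cont_partials_def V_def)
    moreover have "(g (s, t))(i := u) = g (u, t)" "g (s, t) i = s" for u
      using ij by (auto simp: g_def fun_eq_iff)
    ultimately show ?thesis
      by (simp add: partial_def DERIV_deriv_iff_field_differentiable)
  qed
  have dj: "((\<lambda>t. q (g (s, t))) has_real_derivative partial q j (g (s, t))) (at t)"
    if "has_cont_partials n U q" "(s, t) \<in> V" for q s t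
  proof -
    have "(\<lambda>u. q ((g (s, t))(j := u))) field_differentiable at (g (s, t) j)"
      using that ij by (auto simp: has_cont_partials_def V_def)
    moreover have "(g (s, t))(j := u) = g (s, u)" "g (s, t) j = t" for u
      using ij by (auto simp: g_def fun_eq_iff)
    ultimately show ?thesis
      by (simp add: partial_def DERIV_deriv_iff_field_differentiable)
  qed
  have gx: "g (x i, x j) = x" by (auto simp: g_def)
  have "partial (partial f i) j (g (x i, x j)) = partial (partial f j) i (g (x i, x j))"
    using V gx x(1) U(2) ij
    by (intro mixed_partials_commute[of V "x i" "x j" "\<lambda>s t. f (g (s, t))"
          "\<lambda>s t. partial f i (g (s, t))" "\<lambda>s t. partial f j (g (s, t))"
          "\<lambda>s t. partial (partial f i) j (g (s, t))" "\<lambda>s t. partial (partial f j) i (g (s, t))"]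
        di dj cpg U) (auto simp: V_def)
  then show ?thesis using ij by (simp add: gx hess_def)
qed (auto simp: hess_def)

section \<open>Derivatives of the quadratic and cubic parts of the model\<close>

lemma has_real_derivative_cubed_norm:
  fixes c :: real
  assumes c: "0 \<le> c"
  shows "((\<lambda>u. sqrt (c + u\<^sup>2) ^ 3) has_real_derivative 3 * sqrt (c + v\<^sup>2) * v) (at v)"
proof (cases "c + v\<^sup>2 = 0")
  case True
  then have "c = 0" "v = 0"
    using c by (simp_all add: add_nonneg_eq_0_iff)
  \<comment> \<open>Where the norm vanishes the square root is not differentiable and the chain rule
    fails. There the function is the cube of the absolute value, and Caratheodory's criterion holds
    with slope function \<open>u * \<bar>u\<bar>\<close>.\<close>
  moreover have "isCont (\<lambda>u::real. u * \<bar>u\<bar>) 0" by (intro continuous_intros)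
  then have "((\<lambda>u::real. \<bar>u\<bar> ^ 3) has_real_derivative 0) (at 0)"
    unfolding CARAT_DERIV
    by (intro exI[of _ "\<lambda>u. u * \<bar>u\<bar>"]) (auto simp: power3_eq_cube)
  ultimately show ?thesis by simp
next
  case False
  then have "0 < c + v\<^sup>2" using c by (simp add: add_nonneg_pos order_less_le)
  then show ?thesis
    by (auto intro!: derivative_eq_intros simp: field_simps power2_eq_square)
qed

text \<open>Along coordinate \<open>i\<close> the displacement is \<open>d(i := t - xt i)\<close>,
  so each summand is a function of one real variable. The factor 3 from the cubed norm turns
  \<open>\<beta>2 / 6\<close> into \<open>\<beta>2 / 2\<close>.\<close>

lemma partial_Q_model:
  assumes C2: "C2_over n S f" and xt: "xt \<in> S" "xt \<in> Rn n" and i: "i < n"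
  shows "partial (Q_model asm n f \<beta>2 xt) i y =
     grad n f xt i + mat_vec n (hess n f xt) (vdiff y xt) i
     + (case asm of Assm_A \<Rightarrow> 0 | Assm_B \<Rightarrow> \<beta>2 / 2 * norm_n n (vdiff y xt) * vdiff y xt i)"
proof -
  let ?A = "hess n f xt" and ?g = "grad n f xt"
  define d where "d = vdiff y xt"
  define c where "c = (\<Sum>k\<in>{..<n} - {i}. (d k)\<^sup>2)"
  have c: "0 \<le> c" unfolding c_def by (intro sum_nonneg) auto
  have nrm: "norm_n n (d(i := u)) = sqrt (c + u\<^sup>2)" for u
    using i by (simp add: norm_n_def L2_set_def c_def sum.remove[of "{..<n}" i] add.commute)
  have dk: "((\<lambda>t. (d(i := t - xt i)) k) has_real_derivative (if k = i then 1 else 0)) (at (y i))" for k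
    by (auto intro!: derivative_eq_intros)
  have yi: "d(i := y i - xt i) = d" by (auto simp: d_def vdiff_def)
  have cub: "((\<lambda>t. norm_n n (d(i := t - xt i)) ^ 3) has_real_derivative 3 * norm_n n d * d i) (at (y i))"
  proof -
    have "((\<lambda>t. sqrt (c + (t - xt i)\<^sup>2) ^ 3) has_real_derivative
        3 * sqrt (c + (y i - xt i)\<^sup>2) * (y i - xt i) * (1 - 0)) (at (y i))"
      by (rule DERIV_chain'[where g = "\<lambda>u. sqrt (c + u\<^sup>2) ^ 3"])
        (auto intro!: derivative_eq_intros has_real_derivative_cubed_norm[OF c])
    then show ?thesis using nrm[of "y i - xt i"] unfolding nrm yi by (simp add: d_def vdiff_def)
  qed
  have lin: "((\<lambda>t. inner_n n (d(i := t - xt i)) ?g) has_real_derivative ?g i) (at (y i))"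
  proof -
    have "((\<lambda>t. inner_n n (d(i := t - xt i)) ?g) has_real_derivative
        (\<Sum>k<n. (if k = i then 1 else 0) * ?g k)) (at (y i))"
      unfolding inner_n_def by (intro DERIV_sum DERIV_cmult_right dk)
    also have "(\<Sum>k<n. (if k = i then 1 else 0) * ?g k) = ?g i"
      using i by (simp add: if_distrib[of "\<lambda>a. a * _"] cong: if_cong)
    finally show ?thesis .
  qed
  have quad: "((\<lambda>t. inner_n n (d(i := t - xt i)) (mat_vec n ?A (d(i := t - xt i))))
      has_real_derivative 2 * mat_vec n ?A d i) (at (y i))"
  proof -
    have "((\<lambda>t. \<Sum>k<n. (d(i := t - xt i)) k * (\<Sum>l<n. ?A k l * (d(i := t - xt i)) l))
        has_real_derivative (\<Sum>k<n. (if k = i then 1 else 0) * (\<Sum>l<n. ?A k l * (d(i := y i - xt i)) l)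
          + (\<Sum>l<n. ?A k l * (if l = i then 1 else 0)) * (d(i := y i - xt i)) k)) (at (y i))"
      by (intro DERIV_sum DERIV_mult DERIV_cmult dk)
    also have "(\<Sum>k<n. (if k = i then 1 else 0) * (\<Sum>l<n. ?A k l * (d(i := y i - xt i)) l)
          + (\<Sum>l<n. ?A k l * (if l = i then 1 else 0)) * (d(i := y i - xt i)) k)
        = (\<Sum>l<n. ?A i l * d l) + (\<Sum>k<n. ?A k i * d k)"
      unfolding yi sum.distrib using i
      by (simp add: if_distrib[of "\<lambda>a. a * _"] if_distrib[of "\<lambda>a. _ * a"] cong: if_cong)
    \<comment> \<open>Symmetry of the Hessian turns the column sum into a second copy of the row
      sum.\<close>
    also have "(\<Sum>k<n. ?A k i * d k) = (\<Sum>l<n. ?A i l * d l)"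
      by (simp add: hess_symmetric[OF C2 xt, of _ i])
    finally show ?thesis using i by (simp add: inner_n_def mat_vec_def cong: sum.cong_simp)
  qed
  have upd: "vdiff (y(i := t)) xt = d(i := t - xt i)" for t
    by (auto simp: d_def vdiff_def)
  have "((\<lambda>t. Q_model asm n f \<beta>2 xt (y(i := t))) has_real_derivative
     ?g i + mat_vec n ?A d i + (case asm of Assm_A \<Rightarrow> 0 | Assm_B \<Rightarrow> \<beta>2 / 2 * norm_n n d * d i)) (at (y i))"
    unfolding Q_model_def upd
    using DERIV_add[OF lin DERIV_cdivide[OF quad, of 2]]
      DERIV_add[OF DERIV_add[OF lin DERIV_cdivide[OF quad, of 2]] DERIV_cmult[OF cub, of "\<beta>2 / 6"]]
    by (cases asm) (simp_all add: algebra_simps)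
  then show ?thesis unfolding partial_def d_def by (rule DERIV_imp_deriv)
qed

section \<open>Running programs\<close>

abbreviation NV :: "string \<Rightarrow> nexp" where "NV a \<equiv> NCell a (NConst 0)"
abbreviation RV :: "string \<Rightarrow> rexp" where "RV a \<equiv> RCell a (NConst 0)"
abbreviation RI :: "string \<Rightarrow> rexp" where "RI a \<equiv> RCell a (NV ''i'')"
abbreviation seq :: "com \<Rightarrow> com \<Rightarrow> com" (infixr ";;" 60) where "c1 ;; c2 \<equiv> Seq c1 c2"

text \<open>The frame condition of the program logic. It speaks of whole arrays, so that
  interference is decided by comparing name literals instead of cell indices.\<close>

definition changes :: "string set \<Rightarrow> string set \<Rightarrow> memory \<Rightarrow> memory \<Rightarrow> bool" where
  "changes A B m m' \<longleftrightarrow>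
     (\<forall>a. a \<notin> A \<longrightarrow> nats m' a = nats m a) \<and> (\<forall>a. a \<notin> B \<longrightarrow> reals m' a = reals m a)"

lemma changes_trans:
  assumes "changes A B m m'" "changes A' B' m' m''" "A \<union> A' \<subseteq> C" "B \<union> B' \<subseteq> D"
  shows "changes C D m m''"
  using assms unfolding changes_def by (metis Un_iff subsetD)

lemma changes_nats: "changes A B m m' \<Longrightarrow> a \<notin> A \<Longrightarrow> nats m' a = nats m a"
  by (simp add: changes_def)

lemma changes_reals: "changes A B m m' \<Longrightarrow> a \<notin> B \<Longrightarrow> reals m' a = reals m a"
  by (simp add: changes_def)

lemma changes_reals_eq: "changes A {} m m' \<Longrightarrow> reals m' = reals m"
  by (auto simp: changes_def)

lemmas writes = nat_write_def real_write_def block_write_def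

definition for_to :: "string \<Rightarrow> com \<Rightarrow> com" where
  "for_to b c = NAssign ''i'' (NConst 0) (NConst 0) ;;
     While (NLess (NV ''i'') (NV b)) (c ;; NAssign ''i'' (NConst 0) (NAdd (NV ''i'') (NConst 1)))"

definition fill :: "string \<Rightarrow> string \<Rightarrow> rexp \<Rightarrow> com" where
  "fill a b e = for_to b (RAssign a (NV ''i'') e)"

definition sum_to :: "string \<Rightarrow> string \<Rightarrow> rexp \<Rightarrow> com" where
  "sum_to a b e = RAssign a (NConst 0) (RConst 0) ;;
     for_to b (RAssign a (NConst 0) (RAdd (RV a) e))"

text \<open>Code without loops and queries always terminates, with \<open>cost\<close> as a time
  bound and \<open>result\<close> as its effect. The clauses of these two functions for other
  commands are dummies, and \<open>exec_straight\<close> excludes them by assuming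
  \<open>straight\<close>.\<close>

primrec straight :: "com \<Rightarrow> bool" where
  "straight Skip = True"
| "straight (NAssign a i e) = True"
| "straight (RAssign a i e) = True"
| "straight (Seq c1 c2) = (straight c1 \<and> straight c2)"
| "straight (Cond b c1 c2) = (straight c1 \<and> straight c2)"
| "straight (While b c) = False"
| "straight (Project idx len src dst) = False"
| "straight (Multiply src dst) = False"

primrec cost :: "com \<Rightarrow> nat" where
  "cost Skip = 1"
| "cost (NAssign a i e) = 1"
| "cost (RAssign a i e) = 1"
| "cost (Seq c1 c2) = cost c1 + cost c2"
| "cost (Cond b c1 c2) = max (cost c1) (cost c2) + 1"
| "cost (While b c) = 0"
| "cost (Project idx len src dst) = 0"
| "cost (Multiply src dst) = 0"

primrec result :: "com \<Rightarrow> memory \<Rightarrow> memory" where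
  "result Skip m = m"
| "result (NAssign a i e) m = nat_write a (nval i m) (nval e m) m"
| "result (RAssign a i e) m = real_write a (nval i m) (rval e m) m"
| "result (Seq c1 c2) m = result c2 (result c1 m)"
| "result (Cond b c1 c2) m = (if bval b m then result c1 m else result c2 m)"
| "result (While b c) m = m"
| "result (Project idx len src dst) m = m"
| "result (Multiply src dst) m = m"

section \<open>A program logic with time bounds and query lists\<close>

context
  fixes n :: nat and P :: "nat set \<Rightarrow> vec \<Rightarrow> vec" and H :: "vec \<Rightarrow> vec"
begin

text \<open>A total-correctness triple. Bounding the time from above instead of fixing it lets both
  branches of a conditional share one bound.\<close>

definition runs :: "com \<Rightarrow> memory \<Rightarrow> nat \<Rightarrow> (query list \<Rightarrow> memory \<Rightarrow> bool) \<Rightarrow> bool" where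
  "runs c m T Q \<longleftrightarrow> (\<exists>t qs m'. exec n P H c m t qs m' \<and> t \<le> T \<and> Q qs m')"

lemma runs_mono:
  assumes "runs c m T Q" "T \<le> T'" "\<And>qs m'. Q qs m' \<Longrightarrow> Q' qs m'"
  shows "runs c m T' Q'"
  using assms unfolding runs_def by (meson order_trans)

text \<open>The first command is query-free, so the query list of the second is that of the whole.
  Oracle calls have their own rules, \<open>runs_Seq_Project\<close> and
  \<open>runs_Seq_Multiply\<close>, which put the query in front.\<close>

lemma runs_Seq:
  assumes "runs c1 m T1 (\<lambda>qs m1. qs = [] \<and> R m1)" "\<And>m1. R m1 \<Longrightarrow> runs c2 m1 T2 Q"
  shows "runs (Seq c1 c2) m (T1 + T2) Q"
proof -
  obtain t1 m1 where 1: "exec n P H c1 m t1 [] m1" "t1 \<le> T1" "R m1"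
    using assms(1) unfolding runs_def by auto
  obtain t2 qs m2 where 2: "exec n P H c2 m1 t2 qs m2" "t2 \<le> T2" "Q qs m2"
    using assms(2)[OF 1(3)] unfolding runs_def by auto
  show ?thesis
    unfolding runs_def using exec_Seq[OF 1(1) 2(1)] 1(2) 2(2,3) by (auto intro: add_mono)
qed

lemma runs_Cond:
  assumes "bval b m \<Longrightarrow> runs c1 m T Q" "\<not> bval b m \<Longrightarrow> runs c2 m T Q"
  shows "runs (Cond b c1 c2) m (T + 1) Q"
  using assms unfolding runs_def
  by (cases "bval b m") (metis add_le_mono1 exec_CondTrue, metis add_le_mono1 exec_CondFalse)

lemma runs_While_False: "\<not> bval b m \<Longrightarrow> Q [] m \<Longrightarrow> 1 \<le> T \<Longrightarrow> runs (While b c) m T Q"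
  unfolding runs_def using exec_WhileFalse by blast

lemma runs_While_True:
  assumes "bval b m" "runs c m T1 (\<lambda>qs m1. qs = [] \<and> R m1)"
    "\<And>m1. R m1 \<Longrightarrow> runs (While b c) m1 T2 Q"
  shows "runs (While b c) m (T1 + T2 + 1) Q"
proof -
  obtain t1 m1 where 1: "exec n P H c m t1 [] m1" "t1 \<le> T1" "R m1"
    using assms(2) unfolding runs_def by auto
  obtain t2 qs m2 where 2: "exec n P H (While b c) m1 t2 qs m2" "t2 \<le> T2" "Q qs m2"
    using assms(3)[OF 1(3)] unfolding runs_def by auto
  have "exec n P H (While b c) m (t1 + t2 + 1) ([] @ qs) m2"
    using exec_WhileTrue[OF assms(1) 1(1) 2(1)] .
  then show ?thesis
    unfolding runs_def using 1(2) 2(2,3) by (intro exI[of _ "t1 + t2 + 1"]) auto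
qed

lemma exec_straight: "straight c \<Longrightarrow> \<exists>t\<le>cost c. exec n P H c m t [] (result c m)"
proof (induction c arbitrary: m)
  case (Seq c1 c2)
  then obtain t1 t2 where t: "t1 \<le> cost c1" "t2 \<le> cost c2" and 1: "exec n P H c1 m t1 [] (result c1 m)"
    and 2: "exec n P H c2 (result c1 m) t2 [] (result c2 (result c1 m))"
    by (meson straight.simps(4))
  show ?case
    using exec_Seq[OF 1 2] t by (intro exI[of _ "t1 + t2"]) simp
next
  case (Cond b c1 c2)
  then obtain t1 t2 where "t1 \<le> cost c1" "exec n P H c1 m t1 [] (result c1 m)"
    "t2 \<le> cost c2" "exec n P H c2 m t2 [] (result c2 m)"
    by (meson straight.simps(5))
  then have "t1 + 1 \<le> cost (Cond b c1 c2)" "t2 + 1 \<le> cost (Cond b c1 c2)"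
    "bval b m \<Longrightarrow> exec n P H (Cond b c1 c2) m (t1 + 1) [] (result c1 m)"
    "\<not> bval b m \<Longrightarrow> exec n P H (Cond b c1 c2) m (t2 + 1) [] (result c2 m)"
    by (auto simp del: One_nat_def intro: exec_CondTrue exec_CondFalse)
  then show ?case by (cases "bval b m") fastforce+
qed (auto simp del: One_nat_def intro: exec.intros)

lemma runs_straight:
  assumes "straight c" "cost c \<le> T" "Q [] (result c m)"
  shows "runs c m T Q"
  using exec_straight[OF assms(1)] assms(2,3) unfolding runs_def by (meson order_trans)

text \<open>The invariant \<open>I k\<close> refers to the memory after the counter has been set to
  \<open>k\<close>. One round costs the body, a test and the increment; the outer 2 pays for the
  initial assignment and the failing test.\<close>

lemma runs_for:
  assumes init: "I 0 (nat_write ''i'' 0 0 m)"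
    and step: "\<And>k m. k < N \<Longrightarrow> I k m \<Longrightarrow> nats m ''i'' 0 = k \<Longrightarrow>
      runs c m T (\<lambda>qs m'. qs = [] \<and> nats m' ''i'' 0 = k \<and> I (Suc k) (nat_write ''i'' 0 (Suc k) m'))"
    and bound: "\<And>k m. I k m \<Longrightarrow> nats m b 0 = N"
  shows "runs (for_to b c) m (N * (T + 2) + 2) (\<lambda>qs m'. qs = [] \<and> nats m' ''i'' 0 = N \<and> I N m')"
proof -
  let ?w = "While (NLess (NV ''i'') (NV b))
    (c ;; NAssign ''i'' (NConst 0) (NAdd (NV ''i'') (NConst 1)))"
  \<comment> \<open>The induction is on the number \<open>j\<close> of remaining rounds, with the
    counter at \<open>N - j\<close>.\<close>
  have loop: "runs ?w m (j * (T + 2) + 1) (\<lambda>qs m'. qs = [] \<and> nats m' ''i'' 0 = N \<and> I N m')"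
    if "I (N - j) m" "nats m ''i'' 0 = N - j" "j \<le> N" for j m
    using that
  proof (induction j arbitrary: m)
    case 0
    then show ?case using bound[of N m] by (intro runs_While_False) auto
  next
    case (Suc j)
    have eq: "Suc (N - Suc j) = N - j" using Suc.prems(3) by simp
    have "runs ?w m (((T + 1) + (j * (T + 2) + 1)) + 1) (\<lambda>qs m'. qs = [] \<and> nats m' ''i'' 0 = N \<and> I N m')"
    proof (rule runs_While_True)
      show "bval (NLess (NV ''i'') (NV b)) m" using Suc.prems bound[of "N - Suc j" m] by simp
      show "runs (c ;; NAssign ''i'' (NConst 0) (NAdd (NV ''i'') (NConst 1))) m (T + 1)
          (\<lambda>qs m'. qs = [] \<and> nats m' ''i'' 0 = N - j \<and> I (N - j) m')"
      proof (rule runs_Seq)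
        show "runs c m T (\<lambda>qs m'. qs = [] \<and> nats m' ''i'' 0 = N - Suc j \<and>
            I (Suc (N - Suc j)) (nat_write ''i'' 0 (Suc (N - Suc j)) m'))"
          using Suc.prems by (intro step) auto
      next
        fix m1 assume "nats m1 ''i'' 0 = N - Suc j \<and>
            I (Suc (N - Suc j)) (nat_write ''i'' 0 (Suc (N - Suc j)) m1)"
        then show "runs (NAssign ''i'' (NConst 0) (NAdd (NV ''i'') (NConst 1))) m1 1
            (\<lambda>qs m'. qs = [] \<and> nats m' ''i'' 0 = N - j \<and> I (N - j) m')"
          unfolding eq using eq by (intro runs_straight) (auto simp: nat_write_def)
      qed
      show "\<And>m1. nats m1 ''i'' 0 = N - j \<and> I (N - j) m1 \<Longrightarrow>
          runs ?w m1 (j * (T + 2) + 1) (\<lambda>qs m'. qs = [] \<and> nats m' ''i'' 0 = N \<and> I N m')"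
        using Suc.IH Suc.prems(3) by simp
    qed
    then show ?case by (rule runs_mono) auto
  qed
  have "runs (for_to b c) m (1 + (N * (T + 2) + 1)) (\<lambda>qs m'. qs = [] \<and> nats m' ''i'' 0 = N \<and> I N m')"
    unfolding for_to_def
  proof (rule runs_Seq)
    show "runs (NAssign ''i'' (NConst 0) (NConst 0)) m 1 (\<lambda>qs m1. qs = [] \<and> m1 = nat_write ''i'' 0 0 m)"
      by (intro runs_straight) auto
    show "\<And>m1. m1 = nat_write ''i'' 0 0 m \<Longrightarrow>
        runs ?w m1 (N * (T + 2) + 1) (\<lambda>qs m'. qs = [] \<and> nats m' ''i'' 0 = N \<and> I N m')"
      using init by (intro loop) (auto simp: nat_write_def)
  qed
  then show ?thesis by (rule runs_mono) auto
qed

text \<open>The expression is evaluated in the memory whose cells below \<open>k\<close> are already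
  overwritten, while cell \<open>k\<close> still has its old value. This covers updates of an array
  in place.\<close>

lemma runs_fill:
  assumes b: "nats m b 0 = N" "b \<noteq> ''i''"
    and e: "\<And>k. k < N \<Longrightarrow> rval e (nat_write ''i'' 0 k (block_write a k f m)) = f k"
  shows "runs (fill a b e) m (3 * N + 2)
     (\<lambda>qs m'. qs = [] \<and> m' = nat_write ''i'' 0 N (block_write a N f m))"
proof -
  let ?I = "\<lambda>k m'. m' = nat_write ''i'' 0 k (block_write a k f m)"
  have "runs (fill a b e) m (N * (1 + 2) + 2) (\<lambda>qs m'. qs = [] \<and> nats m' ''i'' 0 = N \<and> ?I N m')"
    unfolding fill_def
  proof (rule runs_for)
    show "?I 0 (nat_write ''i'' 0 0 m)" by (simp add: writes)
    show "nats m' b 0 = N" if "?I k m'" for k m' using that b by (simp add: writes)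
    show "runs (RAssign a (NV ''i'') e) m' 1 (\<lambda>qs m''. qs = [] \<and> nats m'' ''i'' 0 = k \<and>
        ?I (Suc k) (nat_write ''i'' 0 (Suc k) m''))" if "k < N" "?I k m'" for k m'
      using that e[OF that(1)]
      by (intro runs_straight) (auto simp: writes fun_eq_iff less_Suc_eq)
  qed
  then show ?thesis by (rule runs_mono) auto
qed

lemma runs_sum_to:
  assumes b: "nats m b 0 = N" "b \<noteq> ''i''"
    and e: "\<And>k. k < N \<Longrightarrow> rval e (nat_write ''i'' 0 k (real_write a 0 (\<Sum>j<k. f j) m)) = f k"
  shows "runs (sum_to a b e) m (3 * N + 3)
     (\<lambda>qs m'. qs = [] \<and> m' = nat_write ''i'' 0 N (real_write a 0 (\<Sum>j<N. f j) m))"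
proof -
  let ?I = "\<lambda>k m'. m' = nat_write ''i'' 0 k (real_write a 0 (\<Sum>j<k. f j) m)"
  have "runs (sum_to a b e) m (1 + (N * (1 + 2) + 2)) (\<lambda>qs m'. qs = [] \<and> nats m' ''i'' 0 = N \<and> ?I N m')"
    unfolding sum_to_def
  proof (rule runs_Seq)
    show "runs (RAssign a (NConst 0) (RConst 0)) m 1 (\<lambda>qs m1. qs = [] \<and> m1 = real_write a 0 0 m)"
      by (intro runs_straight) auto
    show "runs (for_to b (RAssign a (NConst 0) (RAdd (RV a) e))) m1 (N * (1 + 2) + 2)
        (\<lambda>qs m'. qs = [] \<and> nats m' ''i'' 0 = N \<and> ?I N m')" if m1: "m1 = real_write a 0 0 m" for m1
    proof (rule runs_for)
      show "?I 0 (nat_write ''i'' 0 0 m1)" by (simp add: writes m1)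
      show "nats m' b 0 = N" if "?I k m'" for k m' using that b by (simp add: writes)
      show "runs (RAssign a (NConst 0) (RAdd (RV a) e)) m' 1 (\<lambda>qs m''. qs = [] \<and> nats m'' ''i'' 0 = k \<and>
          ?I (Suc k) (nat_write ''i'' 0 (Suc k) m''))" if "k < N" "?I k m'" for k m'
        using that e[OF that(1)]
        by (intro runs_straight) (auto simp: writes fun_eq_iff)
    qed
  qed
  then show ?thesis by (rule runs_mono) auto
qed

lemma runs_Seq_Project:
  assumes l: "l = nval len m" and ts: "ts = map (nats m idx) [0..<l]" "sorted_wrt (<) ts"
    "set ts \<subseteq> {..<n}"
    and rest: "runs c (block_write dst l (P (set ts) (block m src l)) m) T
       (\<lambda>qs. Q (Proj_Query (set ts) (block m src l) # qs))"
  shows "runs (Project idx len src dst ;; c) m (T + 1) Q"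
proof -
  obtain t qs m' where "exec n P H c (block_write dst l (P (set ts) (block m src l)) m) t qs m'"
    "t \<le> T" "Q (Proj_Query (set ts) (block m src l) # qs) m'"
    using rest unfolding runs_def by blast
  moreover note exec_Seq[OF exec_Project[OF l ts refl] this(1)]
  ultimately show ?thesis unfolding runs_def by fastforce
qed

lemma runs_Seq_Multiply:
  assumes rest: "runs c (block_write dst n (H (block m src n)) m) T
       (\<lambda>qs. Q (Mult_Query (block m src n) # qs))"
  shows "runs (Multiply src dst ;; c) m (T + 1) Q"
proof -
  obtain t qs m' where "exec n P H c (block_write dst n (H (block m src n)) m) t qs m'"
    "t \<le> T" "Q (Mult_Query (block m src n) # qs) m'"
    using rest unfolding runs_def by blast
  moreover note exec_Seq[OF exec_Multiply[OF refl] this(1)]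
  ultimately show ?thesis unfolding runs_def by fastforce
qed

end

section \<open>Selecting the largest entries with a heap\<close>

text \<open>A heap of size \<open>s\<close> occupies the cells \<open>1, \<dots>, s\<close>; in \<open>heap_at s p k\<close> only the key at \<open>p\<close>
  may be too large for the subheap below it.\<close>

definition heap_at :: "nat \<Rightarrow> nat \<Rightarrow> (nat \<Rightarrow> real) \<Rightarrow> bool" where
  "heap_at s p k \<longleftrightarrow> (\<forall>j\<in>{2..s}. (j div 2 \<noteq> p \<longrightarrow> k (j div 2) \<le> k j) \<and>
     (j div 2 = p \<longrightarrow> 2 \<le> p \<longrightarrow> k (p div 2) \<le> k j))"

definition heap :: "nat \<Rightarrow> (nat \<Rightarrow> real) \<Rightarrow> bool" where
  "heap s k \<longleftrightarrow> (\<forall>j\<in>{2..s}. k (j div 2) \<le> k j)"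

text \<open>At a leaf there is no child whose order could still be violated.\<close>

lemma heap_at_last: "heap_at s p k \<Longrightarrow> s < p + p \<Longrightarrow> heap s k"
  unfolding heap_at_def heap_def by (auto dest!: bspec)

text \<open>The root has no parent, so the clause linking the children to the grandparent is void
  there and the root may receive an arbitrary key.\<close>

lemma heap_at_root: "heap s k \<Longrightarrow> (\<And>j. 1 < j \<Longrightarrow> k' j = k j) \<Longrightarrow> heap_at s 1 k'"
  unfolding heap_at_def heap_def
proof (intro ballI conjI impI)
  fix j assume h: "\<forall>j\<in>{2..s}. k (j div 2) \<le> k j" "\<And>j. 1 < j \<Longrightarrow> k' j = k j"
    and j: "j \<in> {2..s}" "j div 2 \<noteq> 1"
  then have "1 < j div 2" "1 < j" by auto
  then show "k' (j div 2) \<le> k' j" using h j by auto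
qed auto

lemma heap_root_le: "heap s k \<Longrightarrow> j \<in> {1..s} \<Longrightarrow> k 1 \<le> k j"
proof (induction j rule: less_induct)
  case (less j)
  show ?case
  proof (cases "j = 1")
    case False
    then have "j div 2 \<in> {1..s}" "j div 2 < j" "k (j div 2) \<le> k j"
      using less.prems by (auto simp: heap_def)
    then show ?thesis using less.IH less.prems(1) by fastforce
  qed simp
qed

text \<open>The smaller child \<open>c\<close> may take the place of \<open>p\<close>: it does not
  exceed its sibling, and the grandparent clause puts it above the parent of \<open>p\<close>. The
  displaced key can then be wrong only with respect to the children of \<open>c\<close>.\<close>

lemma heap_at_sift:
  assumes h: "heap_at s p k" and p: "1 \<le> p" "p + p \<le> s"
    and c: "c = (if p + p < s \<and> k (p + p + 1) < k (p + p) then p + p + 1 else p + p)"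
    and k': "k' = (if k c < k p then k(p := k c, c := k p) else k)"
  shows "heap_at s c k'"
proof -
  have c2: "c div 2 = p" "p < c" "c \<le> s" using p c by auto
  have sib: "k c \<le> k j" if "j div 2 = p" "j \<le> s" for j
  proof -
    have "j = p + p \<or> j = p + p + 1" using that(1) by presburger
    then show ?thesis using c that(2) by (auto split: if_splits)
  qed
  have up: "k (j div 2) \<le> k j" if "j \<in> {2..s}" "j div 2 \<noteq> p" for j
    using h that by (auto simp: heap_at_def)
  have over: "k (p div 2) \<le> k j" if "j \<in> {2..s}" "j div 2 = p" "2 \<le> p" for j
    using h that by (auto simp: heap_at_def)
  show ?thesis
  proof (cases "k c < k p")
    case True
    then have k': "k' p = k c" "k' c = k p" "\<And>j. j \<noteq> p \<Longrightarrow> j \<noteq> c \<Longrightarrow> k' j = k j"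
      using k' c2 by auto
    show ?thesis
      unfolding heap_at_def
    proof (intro ballI conjI impI)
      fix j assume j: "j \<in> {2..s}" "j div 2 \<noteq> c"
      show "k' (j div 2) \<le> k' j"
      proof (cases "j div 2 = p")
        case p: True
        then have "j \<noteq> p" using j by auto
        then show ?thesis using p True sib[of j] j k' by (cases "j = c") auto
      next
        case False
        then have jc: "j \<noteq> c" using c2 by auto
        show ?thesis
        proof (cases "j = p")
          case jp: True
          \<comment> \<open>This is where the grandparent clause of \<open>heap_at\<close> is used:
            the key arriving at \<open>p\<close> must respect the parent of
            \<open>p\<close>.\<close>
          then have "k (p div 2) \<le> k c" using over[of c] c2 j by auto
          then show ?thesis using jp False j k' by auto
        next
          case jp: False
          show ?thesis using up[OF j(1) False] False j jc jp by (simp add: k')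
        qed
      qed
    next
      fix j assume j: "j \<in> {2..s}" "j div 2 = c" "2 \<le> c"
      then have "j \<noteq> p" "j \<noteq> c" "j div 2 \<noteq> p" using c2 by auto
      then show "k' (c div 2) \<le> k' j" using up[of j] j c2 by (simp add: k')
    qed
  next
    case False
    then have k': "k' = k" using k' by simp
    show ?thesis
      unfolding heap_at_def k'
    proof (intro ballI conjI impI)
      fix j assume j: "j \<in> {2..s}" "j div 2 \<noteq> c"
      show "k (j div 2) \<le> k j"
        using False sib[of j] up[of j] j by (cases "j div 2 = p") auto
    next
      fix j assume j: "j \<in> {2..s}" "j div 2 = c" "2 \<le> c"
      then have "k c \<le> k j" using up[of j] c2 by auto
      then show "k (c div 2) \<le> k j" using False c2 by simp
    qed
  qed
qed

text \<open>The heap stores indices, and their keys are looked up in another array. There is no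
  early exit: without a swap \<open>p\<close> still descends to the smaller child, which is harmless
  for the bound.\<close>

definition sift_body :: com where
  "sift_body =
     NAssign ''c'' (NConst 0) (NAdd (NV ''p'') (NV ''p'')) ;;
     Cond (BAnd (NLess (NV ''c'') (NV ''s''))
            (RLess (RCell ''key'' (NCell ''hp'' (NAdd (NV ''c'') (NConst 1))))
                   (RCell ''key'' (NCell ''hp'' (NV ''c'')))))
       (NAssign ''c'' (NConst 0) (NAdd (NV ''c'') (NConst 1))) Skip ;;
     Cond (RLess (RCell ''key'' (NCell ''hp'' (NV ''c''))) (RCell ''key'' (NCell ''hp'' (NV ''p''))))
       (NAssign ''t'' (NConst 0) (NCell ''hp'' (NV ''p'')) ;;
        NAssign ''hp'' (NV ''p'') (NCell ''hp'' (NV ''c'')) ;;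
        NAssign ''hp'' (NV ''c'') (NV ''t'')) Skip ;;
     NAssign ''p'' (NConst 0) (NV ''c'')"

definition sift :: com where
  "sift = While (BNot (NLess (NV ''s'') (NAdd (NV ''p'') (NV ''p'')))) sift_body"

abbreviation heap_keys :: "memory \<Rightarrow> nat \<Rightarrow> real" where
  "heap_keys m \<equiv> \<lambda>j. reals m ''key'' (nats m ''hp'' j)"

lemma sift_body_result:
  assumes "heap_at s p (heap_keys m)" "inj_on (nats m ''hp'') {1..s}"
    "nats m ''p'' 0 = p" "nats m ''s'' 0 = s" "1 \<le> p" "p + p \<le> s"
  defines "m' \<equiv> result sift_body m"
  shows "\<exists>c. p + p \<le> c \<and> nats m' ''p'' 0 = c \<and> heap_at s c (heap_keys m') \<and>
    inj_on (nats m' ''hp'') {1..s} \<and> nats m' ''hp'' ` {1..s} = nats m ''hp'' ` {1..s} \<and>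
    changes {''p'', ''c'', ''t'', ''hp''} {} m m'"
proof -
  let ?k = "heap_keys m" and ?h = "nats m ''hp''"
  define c where "c = (if p + p < s \<and> ?k (p + p + 1) < ?k (p + p) then p + p + 1 else p + p)"
  have c: "p + p \<le> c" "p < c" "c \<le> s" using assms(5,6) by (auto simp: c_def)
  define h' where "h' = (if ?k c < ?k p then ?h(p := ?h c, c := ?h p) else ?h)"
  have m': "nats m' ''p'' 0 = c" "nats m' ''hp'' = h'" "reals m' = reals m"
    "changes {''p'', ''c'', ''t'', ''hp''} {} m m'"
    using assms(3,4) c(2) unfolding m'_def sift_body_def h'_def c_def changes_def
    by (auto simp: writes fun_eq_iff)
  have "heap_keys m' = (if ?k c < ?k p then ?k(p := ?k c, c := ?k p) else ?k)"
    unfolding m' h'_def by (auto simp: fun_eq_iff)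
  from heap_at_sift[OF assms(1,5,6) c_def this] have "heap_at s c (heap_keys m')" .
  moreover have "bij_betw h' {1..s} (?h ` {1..s})"
  proof (cases "?k c < ?k p")
    case True
    \<comment> \<open>Writing the swap as composition with a transposition preserves both
      injectivity and the set of stored indices.\<close>
    then have "h' = ?h \<circ> Transposition.transpose p c"
      using c by (auto simp: h'_def fun_eq_iff Transposition.transpose_def)
    moreover have "bij_betw (Transposition.transpose p c) {1..s} {1..s}"
      using c assms(5) by (intro permutes_imp_bij permutes_swap_id) auto
    ultimately show ?thesis using assms(2) by (auto intro: bij_betw_trans inj_on_imp_bij_betw)
  next
    case False
    then show ?thesis using assms(2) by (simp add: h'_def inj_on_imp_bij_betw)
  qed
  ultimately show ?thesis using m' c by (auto simp: bij_betw_def)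
qed

text \<open>Each round at least doubles \<open>p\<close>, so \<open>s < p * 2 ^ L\<close> allows at
  most \<open>L\<close> rounds. A round costs 8 for the body and 1 for the test.\<close>

lemma runs_sift:
  assumes "heap_at s p (heap_keys m)" "inj_on (nats m ''hp'') {1..s}"
    "nats m ''p'' 0 = p" "nats m ''s'' 0 = s" "1 \<le> p" "s < p * 2 ^ L"
  shows "runs n P H sift m (9 * L + 1) (\<lambda>qs m'. qs = [] \<and> heap s (heap_keys m') \<and>
    inj_on (nats m' ''hp'') {1..s} \<and> nats m' ''hp'' ` {1..s} = nats m ''hp'' ` {1..s} \<and>
    changes {''p'', ''c'', ''t'', ''hp''} {} m m')"
  using assms
proof (induction L arbitrary: m p)
  case 0
  then have "heap s (heap_keys m)" by (intro heap_at_last[of s p]) auto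
  then show ?case unfolding sift_def using 0
    by (intro runs_While_False) (auto simp: changes_def)
next
  case (Suc L)
  show ?case
  proof (cases "p + p \<le> s")
    case False
    then have "heap s (heap_keys m)" using Suc.prems by (intro heap_at_last[of s p]) auto
    then show ?thesis unfolding sift_def using Suc.prems False
      by (intro runs_While_False) (auto simp: changes_def)
  next
    case True
    obtain c where c: "p + p \<le> c" "nats (result sift_body m) ''p'' 0 = c"
      "heap_at s c (heap_keys (result sift_body m))"
      "inj_on (nats (result sift_body m) ''hp'') {1..s}"
      "nats (result sift_body m) ''hp'' ` {1..s} = nats m ''hp'' ` {1..s}"
      "changes {''p'', ''c'', ''t'', ''hp''} {} m (result sift_body m)"
      using sift_body_result[OF Suc.prems(1-5) True] by blast
    have s: "nats (result sift_body m) ''s'' 0 = s"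
      using c(6) Suc.prems(4) by (simp add: changes_def)
    have "s < (p + p) * 2 ^ L" using Suc.prems(6) by (simp add: algebra_simps)
    also have "\<dots> \<le> c * 2 ^ L" using c(1) by simp
    finally have L: "s < c * 2 ^ L" .
    have "runs n P H sift m (8 + (9 * L + 1) + 1) (\<lambda>qs m'. qs = [] \<and> heap s (heap_keys m') \<and>
      inj_on (nats m' ''hp'') {1..s} \<and> nats m' ''hp'' ` {1..s} = nats m ''hp'' ` {1..s} \<and>
      changes {''p'', ''c'', ''t'', ''hp''} {} m m')"
      unfolding sift_def
    proof (rule runs_While_True)
      show "bval (BNot (NLess (NV ''s'') (NAdd (NV ''p'') (NV ''p'')))) m"
        using True Suc.prems by simp
      show "runs n P H sift_body m 8 (\<lambda>qs m1. qs = [] \<and> m1 = result sift_body m)"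
        by (intro runs_straight) (auto simp: sift_body_def)
      fix m1 assume m1: "m1 = result sift_body m"
      have "runs n P H sift m1 (9 * L + 1) (\<lambda>qs m'. qs = [] \<and> heap s (heap_keys m') \<and>
        inj_on (nats m' ''hp'') {1..s} \<and> nats m' ''hp'' ` {1..s} = nats m1 ''hp'' ` {1..s} \<and>
        changes {''p'', ''c'', ''t'', ''hp''} {} m1 m')"
        using Suc.prems(5) c(1-4) s L unfolding m1 by (intro Suc.IH[of c]) auto
      then show "runs n P H (While (BNot (NLess (NV ''s'') (NAdd (NV ''p'') (NV ''p'')))) sift_body)
        m1 (9 * L + 1) (\<lambda>qs m'. qs = [] \<and> heap s (heap_keys m') \<and>
        inj_on (nats m' ''hp'') {1..s} \<and> nats m' ''hp'' ` {1..s} = nats m ''hp'' ` {1..s} \<and>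
        changes {''p'', ''c'', ''t'', ''hp''} {} m m')"
        unfolding sift_def
      proof (rule runs_mono, goal_cases)
        case (2 qs m')
        have "changes {''p'', ''c'', ''t'', ''hp''} {} m m'"
          by (rule changes_trans[OF c(6)]) (use 2 m1 in auto)
        then show ?case using 2 c(5) by (simp add: m1)
      qed simp
    qed
    then show ?thesis by (rule runs_mono) auto
  qed
qed

text \<open>The invariant of the scan after \<open>k\<close> entries. The indices from
  \<open>n\<close> to n + s - 1 are dummies which keep the heap at size \<open>s\<close> from the
  start, so that a single insertion rule covers filling and replacing.\<close>

definition top_heap :: "nat \<Rightarrow> nat \<Rightarrow> (nat \<Rightarrow> real) \<Rightarrow> nat \<Rightarrow> (nat \<Rightarrow> nat) \<Rightarrow> bool" where
  "top_heap n s key k h \<longleftrightarrow> inj_on h {1..s} \<and> heap s (\<lambda>j. key (h j)) \<and>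
     h ` {1..s} \<subseteq> {..<k} \<union> {n..<n + s} \<and>
     (\<forall>j\<in>{..<k} \<union> {n..<n + s} - h ` {1..s}. \<forall>i\<in>h ` {1..s}. key j \<le> key i)"

lemma top_heap_keep:
  assumes t: "top_heap n s key k h" and le: "key k \<le> key (h 1)"
  shows "top_heap n s key (Suc k) h"
proof -
  have "heap s (\<lambda>j. key (h j))" using t unfolding top_heap_def by blast
  then have "key k \<le> key (h j)" if "j \<in> {1..s}" for j
    using order_trans[OF le heap_root_le[of s "\<lambda>j. key (h j)" j]] that by blast
  then have "key k \<le> key i" if "i \<in> h ` {1..s}" for i
    using that by blast
  then show ?thesis
    using t unfolding top_heap_def lessThan_Suc by blast
qed

text \<open>The old root is the least kept key, so dropping it for a larger one is safe. The last
  claim allows any arrangement \<open>h''\<close> of the same indices because sifting rearranges the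
  cells.\<close>

lemma top_heap_replace:
  assumes t: "top_heap n s key k h" and less: "key (h 1) < key k" and k: "k < n" and s: "1 \<le> s"
  defines "h' \<equiv> h(1 := k)"
  shows "inj_on h' {1..s}" and "heap_at s 1 (\<lambda>j. key (h' j))"
    and "inj_on h'' {1..s} \<Longrightarrow> heap s (\<lambda>j. key (h'' j)) \<Longrightarrow> h'' ` {1..s} = h' ` {1..s} \<Longrightarrow>
      top_heap n s key (Suc k) h''"
proof -
  have inj: "inj_on h {1..s}" and hp: "heap s (\<lambda>j. key (h j))"
    and sub: "h ` {1..s} \<subseteq> {..<k} \<union> {n..<n + s}"
    and out: "\<And>j i. j \<in> {..<k} \<union> {n..<n + s} - h ` {1..s} \<Longrightarrow> i \<in> h ` {1..s} \<Longrightarrow> key j \<le> key i"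
    using t unfolding top_heap_def by blast+
  have knew: "k \<notin> h ` {1..s}" using sub k by auto
  show "inj_on h' {1..s}"
    unfolding h'_def using inj knew by (rule inj_on_fun_updI)
  show "heap_at s 1 (\<lambda>j. key (h' j))"
    by (rule heap_at_root[OF hp]) (simp add: h'_def)
  have "{1..s} = insert 1 {2..s}" using s by auto
  then have img: "h' ` {1..s} = insert k (h ` {2..s})" and img0: "h ` {1..s} = insert (h 1) (h ` {2..s})"
    unfolding \<open>{1..s} = _\<close> h'_def by auto
  have root: "key (h 1) \<le> key i" if "i \<in> h ` {1..s}" for i
    using heap_root_le[OF hp] that by blast
  assume "inj_on h'' {1..s}" "heap s (\<lambda>j. key (h'' j))" and h'': "h'' ` {1..s} = h' ` {1..s}"
  moreover have "h' ` {1..s} \<subseteq> {..<Suc k} \<union> {n..<n + s}"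
    using sub unfolding img img0 by auto
  moreover have "key j \<le> key i"
    if j: "j \<in> {..<Suc k} \<union> {n..<n + s} - h' ` {1..s}" and i: "i \<in> h' ` {1..s}" for i j
  proof -
    have j': "j = h 1 \<or> j \<in> {..<k} \<union> {n..<n + s} - h ` {1..s}"
      using j unfolding img img0 by (auto simp: less_Suc_eq)
    have i': "i = k \<or> i \<in> h ` {1..s}" using i unfolding img img0 by auto
    have h1: "h 1 \<in> h ` {1..s}" using s by auto
    \<comment> \<open>The key of the old root is a threshold between everything left out and
      everything kept.\<close>
    have "key j \<le> key (h 1)" using j' out[OF _ h1] by blast
    also have "key (h 1) \<le> key i" using i' root less_imp_le[OF less] by blast
    finally show ?thesis .
  qed
  ultimately show "top_heap n s key (Suc k) h''"
    unfolding top_heap_def h'' by blast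
qed

text \<open>No dummy survives: a kept dummy would leave fewer than \<open>s\<close> genuine indices
  in the heap, hence a genuine one outside, although its key exceeds that of the dummy.\<close>

lemma top_heap_complete:
  assumes t: "top_heap n s key n h" and s: "s \<le> n"
    and low: "\<forall>i<n. \<forall>j<s. key (n + j) < key i"
  defines "T \<equiv> h ` {1..s}"
  shows "T \<subseteq> {..<n}" "card T = s" "\<And>i j. i \<in> T \<Longrightarrow> j \<in> {..<n} - T \<Longrightarrow> key j \<le> key i"
proof -
  have sub: "T \<subseteq> {..<n} \<union> {n..<n + s}"
    and out: "\<And>j i. j \<in> {..<n} \<union> {n..<n + s} - T \<Longrightarrow> i \<in> T \<Longrightarrow> key j \<le> key i"
    using t unfolding top_heap_def T_def by blast+
  show card: "card T = s" using t by (simp add: top_heap_def T_def card_image)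
  show "T \<subseteq> {..<n}"
  proof (rule ccontr)
    assume "\<not> T \<subseteq> {..<n}"
    then obtain d where d: "d \<in> T" "\<not> d < n" by auto
    then have "d - n < s" "d = n + (d - n)" using sub by auto
    then have dlow: "key d < key i" if "i < n" for i using low that by metis
    have "T \<inter> {..<n} \<subset> T" using d by auto
    then have "card (T \<inter> {..<n}) < s"
      unfolding card[symmetric] by (intro psubset_card_mono) (auto simp: T_def)
    then have "\<not> {..<n} \<subseteq> T" using s by (auto simp: Int_absorb1)
    then obtain i where "i < n" "i \<notin> T" by auto
    then show False using out[of i d] dlow[of i] d by fastforce
  qed
  show "\<And>i j. i \<in> T \<Longrightarrow> j \<in> {..<n} - T \<Longrightarrow> key j \<le> key i" using out by blast
qed

definition insert_body :: com where
  "insert_body =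
     Cond (RLess (RCell ''key'' (NCell ''hp'' (NConst 1))) (RI ''key''))
       ((NAssign ''hp'' (NConst 1) (NV ''i'') ;; NAssign ''p'' (NConst 0) (NConst 1)) ;; sift) Skip"

definition top_indices :: com where
  "top_indices = sum_to ''lo'' ''n'' (RMul (RI ''key'') (RI ''key'')) ;;
     for_to ''s'' (NAssign ''hp'' (NAdd (NV ''i'') (NConst 1)) (NAdd (NV ''n'') (NV ''i'')) ;;
       RAssign ''key'' (NAdd (NV ''n'') (NV ''i'')) (RSub (RConst (-1)) (RV ''lo''))) ;;
     for_to ''n'' insert_body"

lemma runs_insert_body:
  assumes t: "top_heap n s (reals m ''key'') k (nats m ''hp'')" and i: "nats m ''i'' 0 = k" "k < n"
    and s: "nats m ''s'' 0 = s" "1 \<le> s" "s < 2 ^ L"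
  shows "runs N P H insert_body m (9 * L + 4) (\<lambda>qs m'. qs = [] \<and>
     top_heap n s (reals m ''key'') (Suc k) (nats m' ''hp'') \<and>
     changes {''p'', ''c'', ''t'', ''hp''} {} m m')"
proof -
  let ?Q = "\<lambda>qs m'. qs = [] \<and>
     top_heap n s (reals m ''key'') (Suc k) (nats m' ''hp'') \<and>
     changes {''p'', ''c'', ''t'', ''hp''} {} m m'"
  let ?b = "RLess (RCell ''key'' (NCell ''hp'' (NConst 1))) (RI ''key'')"
  let ?w = "NAssign ''hp'' (NConst 1) (NV ''i'') ;; NAssign ''p'' (NConst 0) (NConst 1)"
  have "runs N P H insert_body m ((9 * L + 3) + 1) ?Q"
    unfolding insert_body_def
  proof (rule runs_Cond)
    assume b: "bval ?b m"
    then have less: "reals m ''key'' (nats m ''hp'' 1) < reals m ''key'' k" using i by simp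
    note repl = top_heap_replace[OF t less i(2) s(2)]
    define m1 where "m1 = nat_write ''p'' 0 1 (nat_write ''hp'' 1 k m)"
    have m1: "nats m1 ''hp'' = (nats m ''hp'')(1 := k)" "reals m1 = reals m" "nats m1 ''p'' 0 = 1"
      "nats m1 ''s'' 0 = s" "changes {''p'', ''c'', ''t'', ''hp''} {} m m1"
      using s(1) by (auto simp: m1_def writes changes_def)
    have "runs N P H (?w ;; sift) m (2 + (9 * L + 1)) ?Q"
    proof (rule runs_Seq)
      show "runs N P H ?w m 2 (\<lambda>qs m'. qs = [] \<and> m' = m1)"
        using i by (intro runs_straight) (auto simp: m1_def nat_write_def)
      fix m' assume m': "m' = m1"
      have "runs N P H sift m1 (9 * L + 1) (\<lambda>qs m'. qs = [] \<and> heap s (heap_keys m') \<and>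
        inj_on (nats m' ''hp'') {1..s} \<and> nats m' ''hp'' ` {1..s} = nats m1 ''hp'' ` {1..s} \<and>
        changes {''p'', ''c'', ''t'', ''hp''} {} m1 m')"
      proof (rule runs_sift)
        show "heap_at s 1 (heap_keys m1)" "inj_on (nats m1 ''hp'') {1..s}"
          unfolding m1(1,2) by (fact repl(1,2))+
      qed (use m1(3,4) s(3) in simp_all)
      then show "runs N P H sift m' (9 * L + 1) ?Q"
        unfolding m'
      proof (rule runs_mono, goal_cases)
        case (2 qs m2)
        then have "changes {''p'', ''c'', ''t'', ''hp''} {} m1 m2" by blast
        then have "reals m2 = reals m" unfolding m1(2)[symmetric] by (rule changes_reals_eq)
        moreover have "changes {''p'', ''c'', ''t'', ''hp''} {} m m2"
          by (rule changes_trans[OF m1(5) \<open>changes _ {} m1 m2\<close>]) auto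
        moreover have "top_heap n s (reals m ''key'') (Suc k) (nats m2 ''hp'')"
          using 2 unfolding m1(1) \<open>reals m2 = reals m\<close> by (intro repl(3)) blast+
        ultimately show ?case using 2 by blast
      qed simp
    qed
    then show "runs N P H (?w ;; sift) m (9 * L + 3) ?Q" by (rule runs_mono) auto
  next
    assume "\<not> bval ?b m"
    then have "top_heap n s (reals m ''key'') (Suc k) (nats m ''hp'')"
      using i(1) by (intro top_heap_keep[OF t]) simp
    then show "runs N P H Skip m (9 * L + 3) ?Q"
      by (intro runs_straight) (auto simp: changes_def)
  qed
  then show ?thesis by (rule runs_mono) auto
qed

text \<open>The heap starts with \<open>s\<close> dummies \<open>n, \<dots>, n + s - 1\<close>. Their common key is minus one minus the sum
  of the squares of all keys, which is below every key \<open>x\<close> because \<open>- 1 - x\<^sup>2 < x\<close>.\<close>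

lemma runs_top_indices:
  assumes m: "nats m ''n'' 0 = n" "nats m ''s'' 0 = s" and s: "1 \<le> s" "s \<le> n" "s < 2 ^ L"
  shows "runs N P H top_indices m (n * (9 * L + 13) + 7) (\<lambda>qs m'. qs = [] \<and>
     (\<exists>T. T = nats m' ''hp'' ` {1..s} \<and> T \<subseteq> {..<n} \<and> card T = s \<and>
       (\<forall>i\<in>T. \<forall>j\<in>{..<n} - T. reals m ''key'' j \<le> reals m ''key'' i)) \<and>
     changes {''i'', ''p'', ''c'', ''t'', ''hp''} {''lo'', ''key''} m m')"
proof -
  let ?key = "reals m ''key''"
  define lo where "lo = (\<Sum>j<n. ?key j * ?key j)"
  define key where "key = (\<lambda>j. if j < n then ?key j else if j < n + s then - 1 - lo else ?key j)"
  let ?init = "NAssign ''hp'' (NAdd (NV ''i'') (NConst 1)) (NAdd (NV ''n'') (NV ''i'')) ;;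
       RAssign ''key'' (NAdd (NV ''n'') (NV ''i'')) (RSub (RConst (-1)) (RV ''lo''))"
  define R1 where "R1 = (\<lambda>m'. changes {''i''} {''lo''} m m' \<and> reals m' ''lo'' 0 = lo)"
  define R2 where "R2 = (\<lambda>m'. changes {''i'', ''hp''} {''lo'', ''key''} m m' \<and>
      reals m' ''key'' = key \<and> (\<forall>j<s. nats m' ''hp'' (Suc j) = n + j))"
  have 1: "runs N P H (sum_to ''lo'' ''n'' (RMul (RI ''key'') (RI ''key''))) m (3 * n + 3)
      (\<lambda>qs m'. qs = [] \<and> R1 m')"
    by (rule runs_mono[OF runs_sum_to[OF m(1), where f = "\<lambda>j. ?key j * ?key j"]])
      (auto simp: R1_def writes changes_def lo_def)
  have 2: "runs N P H (for_to ''s'' ?init) m1 (s * (2 + 2) + 2) (\<lambda>qs m'. qs = [] \<and> R2 m')"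
    if R1: "R1 m1" for m1
  proof -
    let ?I = "\<lambda>k m'. changes {''i'', ''hp''} {''lo'', ''key''} m m' \<and> reals m' ''lo'' 0 = lo \<and>
      reals m' ''key'' = (\<lambda>j. if j < n then ?key j else if j < n + k then - 1 - lo else ?key j) \<and>
      (\<forall>j<k. nats m' ''hp'' (Suc j) = n + j)"
    have "runs N P H (for_to ''s'' ?init) m1 (s * (2 + 2) + 2)
        (\<lambda>qs m'. qs = [] \<and> nats m' ''i'' 0 = s \<and> ?I s m')"
    proof (rule runs_for)
      show "?I 0 (nat_write ''i'' 0 0 m1)" using R1 by (auto simp: R1_def writes changes_def)
      show "nats m' ''s'' 0 = s" if "?I k m'" for k m' using that m by (auto simp: changes_def)
      show "runs N P H ?init m' 2 (\<lambda>qs m''. qs = [] \<and> nats m'' ''i'' 0 = k \<and>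
        ?I (Suc k) (nat_write ''i'' 0 (Suc k) m''))"
        if "?I k m'" "nats m' ''i'' 0 = k" for k m'
      proof (rule runs_straight)
        have ch: "changes {''i'', ''hp''} {''lo'', ''key''} m m'" and lo: "reals m' ''lo'' 0 = lo"
          and key: "reals m' ''key'' = (\<lambda>j. if j < n then ?key j else if j < n + k then - 1 - lo else ?key j)"
          and hp: "\<forall>j<k. nats m' ''hp'' (Suc j) = n + j"
          using that(1) by blast+
        have "nats m' ''n'' 0 = n" using m(1) changes_nats[OF ch, of "''n''"] by simp
        then have res: "result ?init m' =
            real_write ''key'' (n + k) (- 1 - lo) (nat_write ''hp'' (Suc k) (n + k) m')"
          using that(2) lo by (simp add: writes)
        show "[] = [] \<and> nats (result ?init m') ''i'' 0 = k \<and>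
          ?I (Suc k) (nat_write ''i'' 0 (Suc k) (result ?init m'))"
          unfolding res
        proof (intro conjI)
          show "changes {''i'', ''hp''} {''lo'', ''key''} m (nat_write ''i'' 0 (Suc k)
              (real_write ''key'' (n + k) (- 1 - lo) (nat_write ''hp'' (Suc k) (n + k) m')))"
            by (rule changes_trans[OF ch, of "{''i'', ''hp''}" "{''key''}"])
              (simp_all add: changes_def writes)
        qed (use that(2) lo key hp in \<open>auto simp: writes less_Suc_eq\<close>)
      qed auto
    qed
    then show ?thesis by (rule runs_mono) (auto simp: R2_def key_def)
  qed
  have low: "\<forall>i<n. \<forall>j<s. key (n + j) < key i"
  proof (intro allI impI)
    fix i j assume that: "i < n" "j < s"
    have "?key i * ?key i \<le> lo"
      unfolding lo_def using that by (intro member_le_sum) auto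
    \<comment> \<open>The positive quantity is x^2 + x + 1 with the square completed.\<close>
    moreover have "0 < (?key i + 1 / 2)\<^sup>2 + 3 / 4" by (simp add: add_nonneg_pos)
    then have "- 1 - ?key i * ?key i < ?key i" by (simp add: power2_eq_square algebra_simps)
    ultimately show "key (n + j) < key i" using that by (simp add: key_def)
  qed
  have 3: "runs N P H (for_to ''n'' insert_body) m2 (n * ((9 * L + 4) + 2) + 2) (\<lambda>qs m'. qs = [] \<and>
     (\<exists>T. T = nats m' ''hp'' ` {1..s} \<and> T \<subseteq> {..<n} \<and> card T = s \<and>
       (\<forall>i\<in>T. \<forall>j\<in>{..<n} - T. reals m ''key'' j \<le> reals m ''key'' i)) \<and>
     changes {''i'', ''p'', ''c'', ''t'', ''hp''} {''lo'', ''key''} m m')"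
    if R2: "R2 m2" for m2
  proof -
    let ?I = "\<lambda>k m'. top_heap n s key k (nats m' ''hp'') \<and> reals m' ''key'' = key \<and>
      changes {''i'', ''p'', ''c'', ''t'', ''hp''} {''lo'', ''key''} m m'"
    have "runs N P H (for_to ''n'' insert_body) m2 (n * ((9 * L + 4) + 2) + 2)
        (\<lambda>qs m'. qs = [] \<and> nats m' ''i'' 0 = n \<and> ?I n m')"
    proof (rule runs_for[where I = ?I])
      have hp: "nats m2 ''hp'' j = n + (j - 1)" if "j \<in> {1..s}" for j
        using R2 that unfolding R2_def by (cases j) auto
      have "bij_betw (\<lambda>j. n + (j - 1)) {1..s} {n..<n + s}"
        by (rule bij_betwI[of _ _ _ "\<lambda>j. j - n + 1"]) auto
      then have "bij_betw (nats m2 ''hp'') {1..s} {n..<n + s}"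
        by (subst bij_betw_cong[OF hp])
      moreover have key: "key (nats m2 ''hp'' j) = - 1 - lo" if "j \<in> {1..s}" for j
        using hp[OF that] that by (auto simp: key_def)
      \<comment> \<open>All dummies have the same key, so the heap order holds without a building
        phase.\<close>
      have "heap s (\<lambda>j. key (nats m2 ''hp'' j))" unfolding heap_def
      proof
        fix j assume "j \<in> {2..s}"
        then have "j \<in> {1..s}" "j div 2 \<in> {1..s}" by auto
        then show "key (nats m2 ''hp'' (j div 2)) \<le> key (nats m2 ''hp'' j)" using key by simp
      qed
      ultimately have "top_heap n s key 0 (nats m2 ''hp'')"
        by (auto simp: top_heap_def bij_betw_def)
      then show "?I 0 (nat_write ''i'' 0 0 m2)" using R2 by (auto simp: R2_def writes changes_def)
      show "nats m' ''n'' 0 = n" if "?I k m'" for k m' using that m by (auto simp: changes_def)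
      show "runs N P H insert_body m' (9 * L + 4) (\<lambda>qs m''. qs = [] \<and> nats m'' ''i'' 0 = k \<and>
        ?I (Suc k) (nat_write ''i'' 0 (Suc k) m''))"
        if k: "k < n" and I: "?I k m'" and i: "nats m' ''i'' 0 = k" for k m'
      proof -
        have ch': "changes {''i'', ''p'', ''c'', ''t'', ''hp''} {''lo'', ''key''} m m'"
          using I by blast
        have "nats m' ''s'' 0 = s" using m(2) changes_nats[OF ch', of "''s''"] by simp
        then have "runs N P H insert_body m' (9 * L + 4) (\<lambda>qs m''. qs = [] \<and>
            top_heap n s (reals m' ''key'') (Suc k) (nats m'' ''hp'') \<and>
            changes {''p'', ''c'', ''t'', ''hp''} {} m' m'')"
          using I i k s by (intro runs_insert_body) auto
        then show ?thesis
        proof (rule runs_mono, goal_cases)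
          case (2 qs m'')
          then have ch: "changes {''p'', ''c'', ''t'', ''hp''} {} m' m''" by blast
          then have "changes {''i'', ''p'', ''c'', ''t'', ''hp''} {''lo'', ''key''} m m''"
            by (rule changes_trans[OF ch']) auto
          then have "changes {''i'', ''p'', ''c'', ''t'', ''hp''} {''lo'', ''key''} m
              (nat_write ''i'' 0 (Suc k) m'')"
            by (simp add: changes_def nat_write_def)
          then show ?case
            using 2 I i changes_nats[OF ch, of "''i''"] changes_reals_eq[OF ch]
            by (simp add: nat_write_def)
        qed simp
      qed
    qed
    then show ?thesis
    proof (rule runs_mono, goal_cases)
      case (2 qs m')
      then have t: "top_heap n s key n (nats m' ''hp'')" by blast
      note T = top_heap_complete[OF t s(2) low]
      have "?key j \<le> ?key i" if "i \<in> nats m' ''hp'' ` {1..s}" "j \<in> {..<n} - nats m' ''hp'' ` {1..s}" for i j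
        using T(3)[OF that] that T(1) by (auto simp: key_def subset_iff split: if_splits)
      then show ?case using 2 T(1,2) by blast
    qed simp
  qed
  have "runs N P H top_indices m ((3 * n + 3) + ((s * (2 + 2) + 2) + (n * ((9 * L + 4) + 2) + 2)))
    (\<lambda>qs m'. qs = [] \<and>
     (\<exists>T. T = nats m' ''hp'' ` {1..s} \<and> T \<subseteq> {..<n} \<and> card T = s \<and>
       (\<forall>i\<in>T. \<forall>j\<in>{..<n} - T. reals m ''key'' j \<le> reals m ''key'' i)) \<and>
     changes {''i'', ''p'', ''c'', ''t'', ''hp''} {''lo'', ''key''} m m')"
    unfolding top_indices_def by (intro runs_Seq[OF 1] runs_Seq[OF 2] 3)
  then show ?thesis by (rule runs_mono) (use s(2) in \<open>simp_all add: algebra_simps\<close>)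
qed

section \<open>Listing the selected indices in order and scattering the projected vector\<close>

definition list_indices :: com where
  "list_indices = for_to ''n'' (NAssign ''mark'' (NV ''i'') (NConst 0)) ;;
     for_to ''s'' (NAssign ''mark'' (NCell ''hp'' (NAdd (NV ''i'') (NConst 1))) (NConst 1)) ;;
     NAssign ''cnt'' (NConst 0) (NConst 0) ;;
     for_to ''n'' (Cond (NLess (NConst 0) (NCell ''mark'' (NV ''i'')))
       (NAssign ''idx'' (NV ''cnt'') (NV ''i'') ;; RAssign ''src'' (NV ''cnt'') (RI ''z'') ;;
        NAssign ''cnt'' (NConst 0) (NAdd (NV ''cnt'') (NConst 1))) Skip)"

lemma sorted_list_of_set_eq_filter:
  assumes "T \<subseteq> {..<n}"
  shows "sorted_list_of_set T = filter (\<lambda>j. j \<in> T) [0..<n]"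
proof (rule sorted_distinct_set_unique)
  have "finite T" using assms finite_subset by blast
  then show "set (sorted_list_of_set T) = set (filter (\<lambda>j. j \<in> T) [0..<n])" using assms by auto
qed (auto simp: sorted_wrt_filter)

text \<open>Scanning the marks from left to right lists \<open>T\<close> in increasing order, as the
  projection oracle demands, in linear time. The marks are cleared beforehand because memory
  persists between iterations.\<close>

lemma runs_list_indices:
  assumes m: "nats m ''n'' 0 = n" "nats m ''s'' 0 = s"
    and T: "T = nats m ''hp'' ` {1..s}" "T \<subseteq> {..<n}" "card T = s" and s: "s \<le> n"
  shows "runs N P H list_indices m (12 * n + 7) (\<lambda>qs m'. qs = [] \<and>
     map (nats m' ''idx'') [0..<s] = sorted_list_of_set T \<and>
     (\<forall>k<s. reals m' ''src'' k = reals m ''z'' (sorted_list_of_set T ! k)) \<and>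
     changes {''i'', ''mark'', ''cnt'', ''idx''} {''src''} m m')"
proof -
  let ?A = "{''i'', ''mark''}"
  let ?clear = "NAssign ''mark'' (NV ''i'') (NConst 0)"
  let ?set = "NAssign ''mark'' (NCell ''hp'' (NAdd (NV ''i'') (NConst 1))) (NConst 1)"
  let ?save = "NAssign ''idx'' (NV ''cnt'') (NV ''i'') ;; RAssign ''src'' (NV ''cnt'') (RI ''z'') ;;
        NAssign ''cnt'' (NConst 0) (NAdd (NV ''cnt'') (NConst 1))"
  let ?scan = "Cond (NLess (NConst 0) (NCell ''mark'' (NV ''i''))) ?save Skip"
  define R1 where "R1 = (\<lambda>m'. (\<forall>j<n. nats m' ''mark'' j = 0) \<and> changes ?A {} m m')"
  define R2 where "R2 = (\<lambda>m'. (\<forall>j<n. 0 < nats m' ''mark'' j \<longleftrightarrow> j \<in> T) \<and> changes ?A {} m m')"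
  define R3 where "R3 = (\<lambda>m'. (\<forall>j<n. 0 < nats m' ''mark'' j \<longleftrightarrow> j \<in> T) \<and> nats m' ''cnt'' 0 = 0 \<and>
    changes {''i'', ''mark'', ''cnt''} {} m m')"
  have 1: "runs N P H (for_to ''n'' ?clear) m (n * (1 + 2) + 2) (\<lambda>qs m'. qs = [] \<and> R1 m')"
  proof -
    let ?I = "\<lambda>k m'. (\<forall>j<k. nats m' ''mark'' j = 0) \<and> changes ?A {} m m'"
    have "runs N P H (for_to ''n'' ?clear) m (n * (1 + 2) + 2)
        (\<lambda>qs m'. qs = [] \<and> nats m' ''i'' 0 = n \<and> ?I n m')"
    proof (rule runs_for[where I = ?I])
      show "?I 0 (nat_write ''i'' 0 0 m)" by (simp add: changes_def nat_write_def)
      show "nats m' ''n'' 0 = n" if "?I k m'" for k m'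
        using that changes_nats[of ?A "{}" m m' "''n''"] m(1) by simp
      show "runs N P H ?clear m' 1 (\<lambda>qs m''. qs = [] \<and> nats m'' ''i'' 0 = k \<and>
          ?I (Suc k) (nat_write ''i'' 0 (Suc k) m''))" if "?I k m'" "nats m' ''i'' 0 = k" for k m'
        using that by (intro runs_straight) (simp_all add: changes_def nat_write_def less_Suc_eq)
    qed
    then show ?thesis by (rule runs_mono) (simp_all add: R1_def)
  qed
  have 2: "runs N P H (for_to ''s'' ?set) m1 (s * (1 + 2) + 2) (\<lambda>qs m'. qs = [] \<and> R2 m')"
    if R1: "R1 m1" for m1
  proof -
    let ?I = "\<lambda>k m'. (\<forall>j<n. 0 < nats m' ''mark'' j \<longleftrightarrow> j \<in> nats m ''hp'' ` {1..k}) \<and> changes ?A {} m m'"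
    have "runs N P H (for_to ''s'' ?set) m1 (s * (1 + 2) + 2)
        (\<lambda>qs m'. qs = [] \<and> nats m' ''i'' 0 = s \<and> ?I s m')"
    proof (rule runs_for[where I = ?I])
      show "?I 0 (nat_write ''i'' 0 0 m1)" using R1 by (simp add: R1_def changes_def nat_write_def)
      show "nats m' ''s'' 0 = s" if "?I k m'" for k m'
        using that changes_nats[of ?A "{}" m m' "''s''"] m(2) by simp
      show "runs N P H ?set m' 1 (\<lambda>qs m''. qs = [] \<and> nats m'' ''i'' 0 = k \<and>
          ?I (Suc k) (nat_write ''i'' 0 (Suc k) m''))" if I: "?I k m'" and i: "nats m' ''i'' 0 = k" for k m'
      proof (rule runs_straight)
        have ch: "changes ?A {} m m'" using I by blast
        have "result ?set m' = nat_write ''mark'' (nats m ''hp'' (Suc k)) 1 m'"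
          using i changes_nats[OF ch, of "''hp''"] by simp
        moreover have "changes ?A {} m
            (nat_write ''i'' 0 (Suc k) (nat_write ''mark'' (nats m ''hp'' (Suc k)) 1 m'))"
          by (rule changes_trans[OF ch, of ?A "{}"]) (simp_all add: changes_def nat_write_def)
        moreover have "{1..Suc k} = insert (Suc k) {1..k}" by auto
        ultimately show "[] = [] \<and> nats (result ?set m') ''i'' 0 = k \<and>
            ?I (Suc k) (nat_write ''i'' 0 (Suc k) (result ?set m'))"
          using i I by (simp add: nat_write_def)
      qed simp_all
    qed
    then show ?thesis by (rule runs_mono) (simp_all add: R2_def T(1))
  qed
  have 3: "runs N P H (NAssign ''cnt'' (NConst 0) (NConst 0)) m2 1 (\<lambda>qs m'. qs = [] \<and> R3 m')"
    if "R2 m2" for m2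
    using that by (intro runs_straight) (simp_all add: R2_def R3_def changes_def nat_write_def)
  have 4: "runs N P H (for_to ''n'' ?scan) m3 (n * (4 + 2) + 2) (\<lambda>qs m'. qs = [] \<and>
     map (nats m' ''idx'') [0..<s] = sorted_list_of_set T \<and>
     (\<forall>k<s. reals m' ''src'' k = reals m ''z'' (sorted_list_of_set T ! k)) \<and>
     changes {''i'', ''mark'', ''cnt'', ''idx''} {''src''} m m')" if R3: "R3 m3" for m3
  proof -
    let ?xs = "\<lambda>k. filter (\<lambda>j. j \<in> T) [0..<k]"
    let ?B = "{''i'', ''mark'', ''cnt'', ''idx''}"
    let ?I = "\<lambda>k m'. (\<forall>j<n. 0 < nats m' ''mark'' j \<longleftrightarrow> j \<in> T) \<and> nats m' ''cnt'' 0 = length (?xs k) \<and>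
      (\<forall>j<length (?xs k). nats m' ''idx'' j = ?xs k ! j \<and> reals m' ''src'' j = reals m ''z'' (?xs k ! j)) \<and>
      changes ?B {''src''} m m'"
    have "runs N P H (for_to ''n'' ?scan) m3 (n * (4 + 2) + 2)
        (\<lambda>qs m'. qs = [] \<and> nats m' ''i'' 0 = n \<and> ?I n m')"
    proof (rule runs_for[where I = ?I])
      show "?I 0 (nat_write ''i'' 0 0 m3)" using R3 by (simp add: R3_def changes_def nat_write_def)
      show "nats m' ''n'' 0 = n" if "?I k m'" for k m'
        using that changes_nats[of ?B "{''src''}" m m' "''n''"] m(1) by simp
      show "runs N P H ?scan m' 4 (\<lambda>qs m''. qs = [] \<and> nats m'' ''i'' 0 = k \<and>
          ?I (Suc k) (nat_write ''i'' 0 (Suc k) m''))"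
        if k: "k < n" and I: "?I k m'" and i: "nats m' ''i'' 0 = k" for k m'
      proof (rule runs_straight)
        have ch: "changes ?B {''src''} m m'" using I by blast
        have z: "reals m' ''z'' = reals m ''z''" using changes_reals[OF ch, of "''z''"] by simp
        show "[] = [] \<and> nats (result ?scan m') ''i'' 0 = k \<and>
            ?I (Suc k) (nat_write ''i'' 0 (Suc k) (result ?scan m'))"
        proof (cases "k \<in> T")
          case True
          define c where "c = length (?xs k)"
          have res: "result ?scan m' = nat_write ''cnt'' 0 (Suc c)
              (real_write ''src'' c (reals m ''z'' k) (nat_write ''idx'' c k m'))"
            using True I i k z by (simp add: c_def nat_write_def real_write_def)
          have "changes ?B {''src''} m (nat_write ''i'' 0 (Suc k) (result ?scan m'))"
            unfolding res
            by (rule changes_trans[OF ch, of ?B "{''src''}"])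
              (simp_all add: changes_def nat_write_def real_write_def)
          then show ?thesis
            using True I i unfolding res
            by (simp add: nat_write_def real_write_def nth_append less_Suc_eq flip: c_def)
        next
          case False
          have res: "result ?scan m' = m'" using False I i k by simp
          have "changes ?B {''src''} m (nat_write ''i'' 0 (Suc k) m')"
            by (rule changes_trans[OF ch, of ?B "{}"]) (simp_all add: changes_def nat_write_def)
          then show ?thesis using False I i unfolding res by (simp add: nat_write_def)
        qed
      qed simp_all
    qed
    then show ?thesis
    proof (rule runs_mono, goal_cases)
      case (2 qs m')
      have srt: "sorted_list_of_set T = ?xs n" using T(2) by (rule sorted_list_of_set_eq_filter)
      then have "length (?xs n) = s" using T(3) by (metis length_sorted_list_of_set)
      then show ?case using 2 unfolding srt by (auto intro!: nth_equalityI)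
    qed simp
  qed
  have "runs N P H list_indices m
      ((n * (1 + 2) + 2) + ((s * (1 + 2) + 2) + (1 + (n * (4 + 2) + 2)))) (\<lambda>qs m'. qs = [] \<and>
     map (nats m' ''idx'') [0..<s] = sorted_list_of_set T \<and>
     (\<forall>k<s. reals m' ''src'' k = reals m ''z'' (sorted_list_of_set T ! k)) \<and>
     changes {''i'', ''mark'', ''cnt'', ''idx''} {''src''} m m')"
    unfolding list_indices_def by (intro runs_Seq[OF 1] runs_Seq[OF 2] runs_Seq[OF 3] 4)
  then show ?thesis by (rule runs_mono) (use s in simp_all)
qed

definition scatter :: com where
  "scatter = fill ''zp'' ''n'' (RConst 0) ;; for_to ''s'' (RAssign ''zp'' (NCell ''idx'' (NV ''i'')) (RI ''dst''))"

lemma runs_scatter: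
  assumes m: "nats m ''n'' 0 = n" "nats m ''s'' 0 = s"
    and T: "T \<subseteq> {..<n}" "card T = s" and s: "s \<le> n"
    and idx: "map (nats m ''idx'') [0..<s] = sorted_list_of_set T"
  shows "runs N P H scatter m (6 * n + 4) (\<lambda>qs m'. qs = [] \<and>
     (\<forall>j<n. reals m' ''zp'' j = embed_vec T (reals m ''dst'') j) \<and> changes {''i''} {''zp''} m m')"
proof -
  let ?body = "RAssign ''zp'' (NCell ''idx'' (NV ''i'')) (RI ''dst'')"
  let ?v = "\<lambda>k j. \<Sum>l<k. (if sorted_list_of_set T ! l = j then 1 else 0) * reals m ''dst'' l"
  define R where "R = (\<lambda>m'. (\<forall>j<n. reals m' ''zp'' j = 0) \<and> changes {''i''} {''zp''} m m')"
  have fin: "finite T" using T(1) finite_subset by blast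
  have nth: "nats m ''idx'' k = sorted_list_of_set T ! k" if "k < s" for k
    unfolding idx[symmetric] using that by simp
  have 1: "runs N P H (fill ''zp'' ''n'' (RConst 0)) m (3 * n + 2) (\<lambda>qs m'. qs = [] \<and> R m')"
    by (rule runs_mono[OF runs_fill[OF m(1), where f = "\<lambda>_. 0"]])
      (simp_all add: R_def changes_def nat_write_def block_write_def)
  have 2: "runs N P H (for_to ''s'' ?body) m1 (s * (1 + 2) + 2) (\<lambda>qs m'. qs = [] \<and>
     (\<forall>j<n. reals m' ''zp'' j = embed_vec T (reals m ''dst'') j) \<and> changes {''i''} {''zp''} m m')"
    if R: "R m1" for m1
  proof -
    let ?I = "\<lambda>k m'. (\<forall>j<n. reals m' ''zp'' j = ?v k j) \<and> changes {''i''} {''zp''} m m'"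
    have "runs N P H (for_to ''s'' ?body) m1 (s * (1 + 2) + 2)
        (\<lambda>qs m'. qs = [] \<and> nats m' ''i'' 0 = s \<and> ?I s m')"
    proof (rule runs_for[where I = ?I])
      show "?I 0 (nat_write ''i'' 0 0 m1)" using R by (simp add: R_def changes_def nat_write_def)
      show "nats m' ''s'' 0 = s" if "?I k m'" for k m'
        using that changes_nats[of "{''i''}" "{''zp''}" m m' "''s''"] m(2) by simp
      show "runs N P H ?body m' 1 (\<lambda>qs m''. qs = [] \<and> nats m'' ''i'' 0 = k \<and>
          ?I (Suc k) (nat_write ''i'' 0 (Suc k) m''))"
        if k: "k < s" and I: "?I k m'" and i: "nats m' ''i'' 0 = k" for k m'
      proof (rule runs_straight)
        let ?t = "sorted_list_of_set T ! k"
        have ch: "changes {''i''} {''zp''} m m'" using I by blast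
        have res: "result ?body m' = real_write ''zp'' ?t (reals m ''dst'' k) m'"
          using i nth[OF k] changes_nats[OF ch, of "''idx''"] changes_reals[OF ch, of "''dst''"] by simp
        have "changes {''i''} {''zp''} m (nat_write ''i'' 0 (Suc k) (result ?body m'))"
          unfolding res
          by (rule changes_trans[OF ch, of "{''i''}" "{''zp''}"])
            (simp_all add: changes_def nat_write_def real_write_def)
        \<comment> \<open>The listed indices are distinct, so the target cell still holds 0 and
          overwriting it agrees with adding the next term of the sum in
          \<open>embed_vec\<close>.\<close>
        moreover have "sorted_list_of_set T ! l \<noteq> ?t" if "l < k" for l
          using that k T(2) fin by (simp add: nth_eq_iff_index_eq)
        then have "?v k ?t = 0" by simp
        ultimately show "[] = [] \<and> nats (result ?body m') ''i'' 0 = k \<and>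
            ?I (Suc k) (nat_write ''i'' 0 (Suc k) (result ?body m'))"
          using I i unfolding res by (simp add: nat_write_def real_write_def)
      qed simp_all
    qed
    then show ?thesis by (rule runs_mono) (simp_all add: embed_vec_def T(2))
  qed
  have "runs N P H scatter m ((3 * n + 2) + (s * (1 + 2) + 2)) (\<lambda>qs m'. qs = [] \<and>
     (\<forall>j<n. reals m' ''zp'' j = embed_vec T (reals m ''dst'') j) \<and> changes {''i''} {''zp''} m m')"
    unfolding scatter_def by (intro runs_Seq[OF 1] 2)
  then show ?thesis by (rule runs_mono) (use s in simp_all)
qed

section \<open>One iteration\<close>

lemma runs_Seq_fill:
  assumes "nats m b 0 = N" "b \<noteq> ''i''"
    "\<And>k. k < N \<Longrightarrow> rval e (nat_write ''i'' 0 k (block_write a k f m)) = f k"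
    "runs n P H c (nat_write ''i'' 0 N (block_write a N f m)) T Q"
  shows "runs n P H (fill a b e ;; c) m ((3 * N + 2) + T) Q"
  by (rule runs_Seq[OF runs_fill[OF assms(1-3)]]) (use assms(4) in simp_all)

lemma runs_Seq_sum_to:
  assumes "nats m b 0 = N" "b \<noteq> ''i''"
    "\<And>k. k < N \<Longrightarrow> rval e (nat_write ''i'' 0 k (real_write a 0 (\<Sum>j<k. f j) m)) = f k"
    "runs n P H c (nat_write ''i'' 0 N (real_write a 0 (\<Sum>j<N. f j) m)) T Q"
  shows "runs n P H (sum_to a b e ;; c) m ((3 * N + 3) + T) Q"
  by (rule runs_Seq[OF runs_sum_to[OF assms(1-3)]]) (use assms(4) in simp_all)

text \<open>The iterate is recomputed from \<open>xt\<close> and the displacement because its array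
  is zero at the start. The scalar \<open>r\<close> is the factor of the displacement in the
  gradient of the cubic term.\<close>

definition gradient :: "setting \<Rightarrow> com" where
  "gradient asm =
     fill ''y'' ''n'' (RAdd (RI ''x'') (RI ''d'')) ;;
     sum_to ''r'' ''n'' (RMul (RI ''d'') (RI ''d'')) ;;
     RAssign ''r'' (NConst 0) (case asm of Assm_A \<Rightarrow> RConst 0
       | Assm_B \<Rightarrow> RMul (RDiv (RV ''beta2'') (RConst 2)) (RSqrt (RV ''r''))) ;;
     fill ''q'' ''n'' (RAdd (RAdd (RI ''g'') (RI ''e'')) (RMul (RV ''r'') (RI ''d'')))"

lemma runs_gradient:
  assumes "nats m ''n'' 0 = n"
  shows "runs N P H (gradient asm) m (9 * n + 8) (\<lambda>qs m'. qs = [] \<and>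
     (\<forall>k<n. reals m' ''y'' k = reals m ''x'' k + reals m ''d'' k) \<and>
     (\<forall>k<n. reals m' ''q'' k = reals m ''g'' k + reals m ''e'' k +
       (case asm of Assm_A \<Rightarrow> 0 | Assm_B \<Rightarrow> reals m ''beta2'' 0 / 2 * norm_n n (reals m ''d'') * reals m ''d'' k)) \<and>
     changes {''i''} {''y'', ''r'', ''q''} m m')"
proof -
  define r where "r = (case asm of Assm_A \<Rightarrow> 0 | Assm_B \<Rightarrow> reals m ''beta2'' 0 / 2 * norm_n n (reals m ''d''))"
  let ?Q = "\<lambda>qs m'. qs = [] \<and>
     (\<forall>k<n. reals m' ''y'' k = reals m ''x'' k + reals m ''d'' k) \<and>
     (\<forall>k<n. reals m' ''q'' k = reals m ''g'' k + reals m ''e'' k + r * reals m ''d'' k) \<and>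
     changes {''i''} {''y'', ''r'', ''q''} m m'"
  have nrm: "norm_n n (reals m ''d'') = sqrt (\<Sum>k<n. reals m ''d'' k * reals m ''d'' k)"
    by (simp add: norm_n_def L2_set_def power2_eq_square)
  define m2 where "m2 = nat_write ''i'' 0 n (real_write ''r'' 0 (\<Sum>k<n. reals m ''d'' k * reals m ''d'' k)
     (nat_write ''i'' 0 n (block_write ''y'' n (\<lambda>k. reals m ''x'' k + reals m ''d'' k) m)))"
  let ?set = "RAssign ''r'' (NConst 0) (case asm of Assm_A \<Rightarrow> RConst 0
       | Assm_B \<Rightarrow> RMul (RDiv (RV ''beta2'') (RConst 2)) (RSqrt (RV ''r'')))"
  let ?fill = "fill ''q'' ''n'' (RAdd (RAdd (RI ''g'') (RI ''e'')) (RMul (RV ''r'') (RI ''d'')))"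
  have 1: "runs N P H ?set m2 1 (\<lambda>qs m'. qs = [] \<and> m' = real_write ''r'' 0 r m2)"
    by (rule runs_straight) (cases asm; simp add: m2_def writes nrm r_def)+
  have 2: "runs N P H ?fill m' (3 * n + 2) ?Q" if m': "m' = real_write ''r'' 0 r m2" for m'
    using assms
    by (intro runs_mono[OF runs_fill[where f = "\<lambda>k. reals m ''g'' k + reals m ''e'' k + r * reals m ''d'' k" and N = n]])
      (simp_all add: m' m2_def writes changes_def)
  have "runs N P H (gradient asm) m ((3 * n + 2) + ((3 * n + 3) + (1 + (3 * n + 2)))) ?Q"
    unfolding gradient_def
  proof (rule runs_Seq_fill[where f = "\<lambda>k. reals m ''x'' k + reals m ''d'' k"],
      goal_cases)
    case 4
    show ?case
      by (rule runs_Seq_sum_to[where f = "\<lambda>k. reals m ''d'' k * reals m ''d'' k"])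
        (use assms runs_Seq[OF 1 2] in \<open>simp_all add: writes m2_def\<close>)
  qed (use assms in \<open>simp_all add: writes\<close>)
  then show ?thesis by (rule runs_mono) (auto simp: r_def split: setting.split)
qed

text \<open>The expression language has no absolute value, so it is computed as the square root of
  the square.\<close>

definition key_exp :: "symmetry \<Rightarrow> rexp" where
  "key_exp kind = (case kind of Nonneg \<Rightarrow> RI ''z'' | Sign_Flips \<Rightarrow> RSqrt (RMul (RI ''z'') (RI ''z'')))"

definition select :: "symmetry \<Rightarrow> com" where
  "select kind =
     fill ''z'' ''n'' (RSub (RI ''y'') (RMul (RDiv (RConst 1) (RMul (RV ''lambda'') (RV ''btilde''))) (RI ''q''))) ;;
     fill ''key'' ''n'' (key_exp kind) ;;
     top_indices ;; list_indices"

lemma runs_select: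
  assumes m: "nats m ''n'' 0 = n" "nats m ''s'' 0 = s" and s: "1 \<le> s" "s \<le> n" "s < 2 ^ L"
    and z: "\<And>k. k < n \<Longrightarrow>
      z k = reals m ''y'' k - 1 / (reals m ''lambda'' 0 * reals m ''btilde'' 0) * reals m ''q'' k"
  shows "runs N P H (select kind) m (n * (9 * L + 31) + 18) (\<lambda>qs m'. qs = [] \<and>
     (\<exists>T. largest_set kind n s z T \<and> map (nats m' ''idx'') [0..<s] = sorted_list_of_set T \<and>
       (\<forall>k<s. reals m' ''src'' k = z (sorted_list_of_set T ! k))) \<and>
     changes {''i'', ''p'', ''c'', ''t'', ''hp'', ''mark'', ''cnt'', ''idx''}
       {''z'', ''lo'', ''key'', ''src''} m m')"
proof -
  let ?B = "{''i'', ''p'', ''c'', ''t'', ''hp''}" and ?C = "{''i'', ''mark'', ''cnt'', ''idx''}"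
  let ?D = "{''i'', ''p'', ''c'', ''t'', ''hp'', ''mark'', ''cnt'', ''idx''}"
  let ?E = "{''z'', ''lo'', ''key'', ''src''}"
  define key where "key = (case kind of Nonneg \<Rightarrow> z | Sign_Flips \<Rightarrow> (\<lambda>k. \<bar>z k\<bar>))"
  define m2 where "m2 = nat_write ''i'' 0 n (block_write ''key'' n key
     (nat_write ''i'' 0 n (block_write ''z'' n z m)))"
  have m2: "nats m2 ''n'' 0 = n" "nats m2 ''s'' 0 = s" "changes ?B {''z'', ''key''} m m2"
    "\<And>k. k < n \<Longrightarrow> reals m2 ''z'' k = z k" "\<And>k. k < n \<Longrightarrow> reals m2 ''key'' k = key k"
    using m by (simp_all add: m2_def writes changes_def)
  let ?R = "\<lambda>m'. (\<exists>T. T = nats m' ''hp'' ` {1..s} \<and> T \<subseteq> {..<n} \<and> card T = s \<and>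
       (\<forall>i\<in>T. \<forall>j\<in>{..<n} - T. reals m2 ''key'' j \<le> reals m2 ''key'' i)) \<and>
     changes ?B {''lo'', ''key''} m2 m'"
  let ?Q = "\<lambda>qs m'. qs = [] \<and>
     (\<exists>T. largest_set kind n s z T \<and> map (nats m' ''idx'') [0..<s] = sorted_list_of_set T \<and>
       (\<forall>k<s. reals m' ''src'' k = z (sorted_list_of_set T ! k))) \<and> changes ?D ?E m m'"
  have 1: "runs N P H top_indices m2 (n * (9 * L + 13) + 7) (\<lambda>qs m'. qs = [] \<and> ?R m')"
    using m2(1,2) s by (rule runs_top_indices)
  have 2: "runs N P H list_indices m3 (12 * n + 7) ?Q" if R: "?R m3" for m3
  proof -
    obtain T where T: "T = nats m3 ''hp'' ` {1..s}" "T \<subseteq> {..<n}" "card T = s"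
      "\<forall>i\<in>T. \<forall>j\<in>{..<n} - T. reals m2 ''key'' j \<le> reals m2 ''key'' i"
      using R by blast
    have ch: "changes ?B {''lo'', ''key''} m2 m3" using R by blast
    have m3: "nats m3 ''n'' 0 = n" "nats m3 ''s'' 0 = s" "reals m3 ''z'' = reals m2 ''z''"
      using m2(1,2) changes_nats[OF ch] changes_reals[OF ch] by simp_all
    have "key j \<le> key i" if "i \<in> T" "j \<in> {..<n} - T" for i j
    proof -
      have "i < n" "j < n" using T(2) that by auto
      then show ?thesis using T(4) that m2(5) by fastforce
    qed
    then have largest: "largest_set kind n s z T"
      using T(2,3) unfolding largest_set_def key_def by (auto split: symmetry.splits)
    have ch2: "changes ?D ?E m m3"
      by (rule changes_trans[OF m2(3) ch]) simp_all
    have fin: "finite T" using T(2) finite_subset by blast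
    show ?thesis
    proof (rule runs_mono[OF runs_list_indices[OF m3(1,2) T(1-3) s(2)]], goal_cases)
      case (2 qs m')
      then have "changes ?C {''src''} m3 m'" by blast
      then have "changes ?D ?E m m'" by (rule changes_trans[OF ch2]) simp_all
      moreover have "reals m3 ''z'' (sorted_list_of_set T ! k) = z (sorted_list_of_set T ! k)" if "k < s" for k
      proof -
        have "sorted_list_of_set T ! k \<in> T"
          using that T(3) fin nth_mem[of k "sorted_list_of_set T"] by simp
        then show ?thesis using m3(3) m2(4) T(2) by auto
      qed
      ultimately show ?case using 2 largest by auto
    qed simp
  qed
  have "runs N P H (select kind) m ((3 * n + 2) + ((3 * n + 2) + ((n * (9 * L + 13) + 7) + (12 * n + 7)))) ?Q"
    unfolding select_def
  proof (rule runs_Seq_fill[where f = z], goal_cases)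
    case 4
    show ?case
    proof (rule runs_Seq_fill[where f = key], goal_cases)
      case 4
      show ?case using runs_Seq[OF 1 2] unfolding m2_def .
    next
      case (3 k)
      then show ?case by (cases kind) (simp_all add: key_exp_def key_def writes)
    qed (use m in \<open>simp_all add: writes\<close>)
  qed (use m z in \<open>simp_all add: writes\<close>)
  then show ?thesis by (rule runs_mono) (simp_all add: algebra_simps)
qed

text \<open>The scalar \<open>val\<close> is the subproblem value at \<open>z'\<close>; the value at
  \<open>y\<close> is 0, so its sign selects the minimizer, with ties going to \<open>y\<close>. If
  \<open>y\<close> wins, the iterate stays put and the stored Hessian product needs no
  change.\<close>

definition update :: com where
  "update =
     sum_to ''val'' ''n'' (RAdd (RMul (RSub (RI ''zp'') (RI ''y'')) (RI ''q''))
       (RMul (RDiv (RMul (RV ''lambda'') (RV ''btilde'')) (RConst 2))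
         (RMul (RSub (RI ''zp'') (RI ''y'')) (RSub (RI ''zp'') (RI ''y''))))) ;;
     Cond (RLess (RV ''val'') (RConst 0))
       (fill ''e'' ''n'' (RAdd (RMul (RSub (RConst 1) (RV ''lambda'')) (RI ''e''))
          (RMul (RV ''lambda'') (RSub (RI ''hz'') (RI ''h'')))) ;;
        fill ''w'' ''n'' (RI ''zp''))
       (fill ''w'' ''n'' (RI ''y'')) ;;
     fill ''y'' ''n'' (RAdd (RMul (RSub (RConst 1) (RV ''lambda'')) (RI ''y''))
       (RMul (RV ''lambda'') (RI ''w''))) ;;
     fill ''d'' ''n'' (RSub (RI ''y'') (RI ''x''))"

lemma runs_update:
  assumes m: "nats m ''n'' 0 = n" and a: "a = reals m ''lambda'' 0"
    and v: "v = (\<Sum>k<n. (reals m ''zp'' k - reals m ''y'' k) * reals m ''q'' k +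
        a * reals m ''btilde'' 0 / 2 * (reals m ''zp'' k - reals m ''y'' k)\<^sup>2)"
    and w: "\<And>k. k < n \<Longrightarrow> w k = (if v < 0 then reals m ''zp'' k else reals m ''y'' k)"
  shows "runs N P H update m (15 * n + 12) (\<lambda>qs m'. qs = [] \<and>
     (\<forall>k<n. reals m' ''w'' k = w k) \<and>
     (\<forall>k<n. reals m' ''e'' k = (if v < 0 then (1 - a) * reals m ''e'' k + a * (reals m ''hz'' k - reals m ''h'' k)
        else reals m ''e'' k)) \<and>
     (\<forall>k<n. reals m' ''y'' k = (1 - a) * reals m ''y'' k + a * w k) \<and>
     (\<forall>k<n. reals m' ''d'' k = (1 - a) * reals m ''y'' k + a * w k - reals m ''x'' k) \<and>
     changes {''i''} {''val'', ''e'', ''w'', ''y'', ''d''} m m')"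
proof -
  let ?val = "\<lambda>k. (reals m ''zp'' k - reals m ''y'' k) * reals m ''q'' k +
        a * reals m ''btilde'' 0 / 2 * (reals m ''zp'' k - reals m ''y'' k)\<^sup>2"
  let ?e = "\<lambda>k. (1 - a) * reals m ''e'' k + a * (reals m ''hz'' k - reals m ''h'' k)"
  let ?y = "\<lambda>k. (1 - a) * reals m ''y'' k + a * w k"
  let ?Q = "\<lambda>qs m'. qs = [] \<and>
     (\<forall>k<n. reals m' ''w'' k = w k) \<and>
     (\<forall>k<n. reals m' ''e'' k = (if v < 0 then ?e k else reals m ''e'' k)) \<and>
     (\<forall>k<n. reals m' ''y'' k = ?y k) \<and>
     (\<forall>k<n. reals m' ''d'' k = ?y k - reals m ''x'' k) \<and>
     changes {''i''} {''val'', ''e'', ''w'', ''y'', ''d''} m m'"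
  define m1 where "m1 = nat_write ''i'' 0 n (real_write ''val'' 0 v m)"
  define R where "R = (\<lambda>m'. (\<forall>k<n. reals m' ''w'' k = w k) \<and>
     (\<forall>k<n. reals m' ''e'' k = (if v < 0 then ?e k else reals m ''e'' k)) \<and>
     changes {''i''} {''val'', ''e'', ''w''} m m')"
  let ?fe = "fill ''e'' ''n'' (RAdd (RMul (RSub (RConst 1) (RV ''lambda'')) (RI ''e''))
          (RMul (RV ''lambda'') (RSub (RI ''hz'') (RI ''h''))))"
  let ?fz = "fill ''w'' ''n'' (RI ''zp'')" and ?fw = "fill ''w'' ''n'' (RI ''y'')"
  let ?fy = "fill ''y'' ''n'' (RAdd (RMul (RSub (RConst 1) (RV ''lambda'')) (RI ''y''))
       (RMul (RV ''lambda'') (RI ''w'')))"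
  let ?fd = "fill ''d'' ''n'' (RSub (RI ''y'') (RI ''x''))"
  have 1: "runs N P H (Cond (RLess (RV ''val'') (RConst 0)) (?fe ;; ?fz) ?fw) m1
      (((3 * n + 2) + (3 * n + 2)) + 1) (\<lambda>qs m'. qs = [] \<and> R m')"
  proof (rule runs_Cond)
    assume "bval (RLess (RV ''val'') (RConst 0)) m1"
    then have v: "v < 0" by (simp add: m1_def writes)
    show "runs N P H (?fe ;; ?fz) m1 ((3 * n + 2) + (3 * n + 2)) (\<lambda>qs m'. qs = [] \<and> R m')"
    proof (rule runs_Seq_fill[where f = ?e], goal_cases)
      case 4
      show ?case
        by (rule runs_mono[OF runs_fill[where f = "reals m ''zp''" and N = n]])
          (use m v w in \<open>simp_all add: m1_def writes R_def changes_def\<close>)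
    qed (use m a in \<open>simp_all add: m1_def writes\<close>)
  next
    assume "\<not> bval (RLess (RV ''val'') (RConst 0)) m1"
    then have v: "\<not> v < 0" by (simp add: m1_def writes)
    show "runs N P H ?fw m1 ((3 * n + 2) + (3 * n + 2)) (\<lambda>qs m'. qs = [] \<and> R m')"
      by (rule runs_mono[OF runs_fill[where f = "reals m ''y''" and N = n]])
        (use m v w in \<open>simp_all add: m1_def writes R_def changes_def\<close>)
  qed
  have 2: "runs N P H (?fy ;; ?fd) m2 ((3 * n + 2) + (3 * n + 2)) ?Q" if R: "R m2" for m2
  proof -
    have ch: "changes {''i''} {''val'', ''e'', ''w''} m m2" using R by (simp add: R_def)
    have m2: "nats m2 ''n'' 0 = n" "reals m2 ''lambda'' 0 = a" "reals m2 ''y'' = reals m ''y''"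
      "reals m2 ''x'' = reals m ''x''"
      using m a changes_nats[OF ch] changes_reals[OF ch] by simp_all
    have we: "\<And>k. k < n \<Longrightarrow> reals m2 ''w'' k = w k"
      "\<And>k. k < n \<Longrightarrow> reals m2 ''e'' k = (if v < 0 then ?e k else reals m ''e'' k)"
      using R by (simp_all add: R_def)
    show ?thesis
    proof (rule runs_Seq_fill[where f = ?y], goal_cases)
      case 4
      show ?case
      proof (rule runs_mono[OF runs_fill[where f = "\<lambda>k. ?y k - reals m ''x'' k" and N = n]], goal_cases)
        case (5 qs m')
        then have m': "qs = []" "m' = nat_write ''i'' 0 n (block_write ''d'' n (\<lambda>k. ?y k - reals m ''x'' k)
            (nat_write ''i'' 0 n (block_write ''y'' n ?y m2)))" by simp_all
        have "changes {''i''} {''val'', ''e'', ''w'', ''y'', ''d''} m m'"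
          unfolding m'
          by (rule changes_trans[OF ch, of "{''i''}" "{''y'', ''d''}"])
            (simp_all add: changes_def writes)
        then show ?case using we m' by (simp add: writes)
      qed (use m2 in \<open>simp_all add: writes\<close>)
    qed (use m2 we in \<open>simp_all add: writes\<close>)
  qed
  have "runs N P H update m ((3 * n + 3) + ((((3 * n + 2) + (3 * n + 2)) + 1) + ((3 * n + 2) + (3 * n + 2)))) ?Q"
    unfolding update_def
  proof (rule runs_Seq_sum_to[where f = ?val], goal_cases)
    case 4
    show ?case using runs_Seq[OF 1 2] unfolding m1_def v .
  next
    case (3 k)
    then show ?case using a by (simp add: writes power2_eq_square)
  qed (use m in simp_all)
  then show ?thesis by (rule runs_mono) simp_all
qed

section \<open>Correctness of the sparse step\<close>

lemma psi_in:
  assumes "x \<in> K"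
  shows "psi n Q b (set_indicator K) y l x =
    ereal (inner_n n (vdiff x y) (grad n Q y) + l * b / 2 * (norm_n n (vdiff x y))\<^sup>2)"
  using assms by (simp add: psi_def set_indicator_def)

lemma eff_dom_set_indicator: "K \<subseteq> Rn n \<Longrightarrow> eff_dom n (set_indicator K) = K"
  by (auto simp: eff_dom_def set_indicator_def)

text \<open>This serves step size 0, where the program calls no oracle: the better of
  \<open>y\<close> and \<open>xs\<close> is an admissible answer, and the next iterate is
  \<open>y\<close> in any case.\<close>

lemma wpo_output_exists:
  assumes "K \<subseteq> Rn n" "y \<in> K" "xs \<in> K"
  shows "\<exists>w\<in>K. wpo_output n Q b (set_indicator K) xs y l w"
proof -
  let ?p = "psi n Q b (set_indicator K) y l"
  have "?p xs \<le> ?p y \<or> ?p y \<le> ?p xs" by (rule linear)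
  then show ?thesis
    using assms unfolding wpo_output_def eff_dom_set_indicator[OF assms(1)] by auto
qed

text \<open>Completing the square: up to a constant, \<open>\<psi>\<close> on \<open>K\<close> is a positive multiple of the squared
  distance to \<open>z\<close>.\<close>

lemma sparse_prox_step_correct:
  assumes sym: "symmetric_set kind n K" and cl: "closedin (Euclidean_space n) K"
    and l: "0 < l" "0 < b" and y: "y \<in> K" and xs: "xs \<in> K" "nnz n xs \<le> s"
    and z: "z = (\<lambda>i. y i - 1 / (l * b) * grad n Q y i)" and T: "largest_set kind n s z T"
    and z': "z' = embed_vec T (projection s (restrict_set K T) (restrict_vec T z))"
    and v: "v = inner_n n (vdiff z' y) (grad n Q y) + l * b / 2 * (norm_n n (vdiff z' y))\<^sup>2"
  defines "w \<equiv> (if v < 0 then z' else y)"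
  shows "sparse_prox_step kind n s Q b K y l w" "wpo_output n Q b (set_indicator K) xs y l w" "w \<in> K"
proof -
  let ?p = "psi n Q b (set_indicator K) y l"
  have KR: "K \<subseteq> Rn n" using cl by (rule closedin_subset)
  have z'K: "z' \<in> K" and near: "norm_n n (vdiff z' z) \<le> norm_n n (vdiff xs z)"
    unfolding z' using sparse_projection_nearest[OF sym cl T xs] by auto
  show wK: "w \<in> K" using z'K y by (simp add: w_def)
  have pz': "?p z' = ereal v" using psi_in[OF z'K] v by simp
  have py: "?p y = 0"
    using psi_in[OF y, of n Q b y l] by (simp add: vdiff_def inner_n_def norm_n_def L2_set_def)
  have pw: "?p w \<le> ?p y" "?p w \<le> ?p z'" using pz' py by (simp_all add: w_def)
  define g where "g = grad n Q y"
  \<comment> \<open>Since z - y = -g / (l b), completing the square leaves the constant -|g|^2 / (2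
    l b), which is the same for all \<open>x\<close>.\<close>
  have sq: "inner_n n (vdiff x y) g + l * b / 2 * (norm_n n (vdiff x y))\<^sup>2
      = l * b / 2 * (norm_n n (vdiff x z))\<^sup>2 - (\<Sum>i<n. (g i)\<^sup>2 / (2 * (l * b)))" for x
  proof -
    have "l * b \<noteq> 0" using l by simp
    then have "(x i - y i) * g i + l * b / 2 * (x i - y i)\<^sup>2
        = l * b / 2 * (x i - z i)\<^sup>2 - (g i)\<^sup>2 / (2 * (l * b))" for i
      unfolding z g_def[symmetric] by (simp add: field_simps power2_eq_square)
    then show ?thesis
      unfolding norm_n_power2 inner_n_def vdiff_def sum_distrib_left
      by (simp flip: sum.distrib sum_subtractf)
  qed
  have "(norm_n n (vdiff z' z))\<^sup>2 \<le> (norm_n n (vdiff xs z))\<^sup>2"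
    using near by (simp add: power_mono norm_n_nonneg)
  then have "l * b / 2 * (norm_n n (vdiff z' z))\<^sup>2 \<le> l * b / 2 * (norm_n n (vdiff xs z))\<^sup>2"
    using l by (intro mult_left_mono) auto
  then have "?p z' \<le> ?p xs"
    unfolding psi_in[OF z'K] psi_in[OF xs(1)] g_def[symmetric] sq by simp
  then show "wpo_output n Q b (set_indicator K) xs y l w"
    unfolding wpo_output_def eff_dom_set_indicator[OF KR] using wK pw by auto
  have "is_arg_min ?p (\<lambda>u. u \<in> {y, z'}) w"
    unfolding is_arg_min_def using pw by (auto simp: w_def not_less)
  then show "sparse_prox_step kind n s Q b K y l w"
    unfolding sparse_prox_step_def using z T z' by blast
qed

text \<open>Linearity, arranged so that the right side combines the stored product for
  \<open>y\<close>, the fresh product with the new vector and the initial product with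
  \<open>xt\<close>.\<close>

lemma mat_vec_comb:
  "mat_vec n A (vdiff (comb a y w) x) k =
     (1 - a) * mat_vec n A (vdiff y x) k + a * (mat_vec n A w k - mat_vec n A x k)"
  by (simp add: mat_vec_def vdiff_def comb_def sum_distrib_left algebra_simps
      flip: sum.distrib sum_subtractf)

text \<open>The test guards the division by the step size. In the other branch the iterate does not
  move, so the stored displacement and Hessian product remain valid.\<close>

definition iteration :: "setting \<Rightarrow> symmetry \<Rightarrow> com" where
  "iteration asm kind = gradient asm ;;
     Cond (RLess (RConst 0) (RV ''lambda''))
       (select kind ;; Project ''idx'' (NV ''s'') ''src'' ''dst'' ;; scatter ;;
        Multiply ''zp'' ''hz'' ;; update) Skip"

text \<open>The arrays \<open>d\<close> and \<open>e\<close> hold \<open>y - x\<^sub>t\<close> and its product with the Hessian. Both vanish initially, so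
  the zero-initialized memory already represents the first iterate.\<close>

definition represents ::
  "nat \<Rightarrow> nat \<Rightarrow> real \<Rightarrow> real \<Rightarrow> vec \<Rightarrow> vec \<Rightarrow> (nat \<Rightarrow> nat \<Rightarrow> real) \<Rightarrow> memory \<Rightarrow> vec \<Rightarrow> bool" where
  "represents n s b \<beta>2 xt g A m y \<longleftrightarrow>
     nats m ''n'' 0 = n \<and> nats m ''s'' 0 = s \<and>
     reals m ''btilde'' 0 = b \<and> reals m ''beta2'' 0 = \<beta>2 \<and>
     (\<forall>k<n. reals m ''x'' k = xt k \<and> reals m ''g'' k = g k \<and> reals m ''h'' k = mat_vec n A xt k \<and>
        reals m ''d'' k = vdiff y xt k \<and> reals m ''e'' k = mat_vec n A (vdiff y xt) k)"

lemma represents_changes: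
  assumes "represents n s b \<beta>2 xt g A m y" "changes C D m m'"
    "C \<inter> {''n'', ''s''} = {}" "D \<inter> {''btilde'', ''beta2'', ''x'', ''g'', ''h''} = {}"
    "\<And>k. k < n \<Longrightarrow> reals m' ''d'' k = vdiff y' xt k"
    "\<And>k. k < n \<Longrightarrow> reals m' ''e'' k = mat_vec n A (vdiff y' xt) k"
  shows "represents n s b \<beta>2 xt g A m' y'"
  using assms unfolding represents_def changes_def by auto

lemma block_eq: "x \<in> Rn n \<Longrightarrow> (\<And>k. k < n \<Longrightarrow> reals m a k = x k) \<Longrightarrow> block m a n = x"
  by (auto simp: block_def in_Rn_iff fun_eq_iff)

lemma norm_n_cong: "(\<And>k. k < n \<Longrightarrow> x k = y k) \<Longrightarrow> norm_n n x = norm_n n y"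
  unfolding norm_n_def by (rule L2_set_cong) auto

lemma nnz_embed_vec:
  assumes "T \<subseteq> {..<n}"
  shows "nnz n (embed_vec T u) \<le> card T"
proof -
  have fin: "finite T" using assms finite_subset by blast
  then have "{i. i < n \<and> embed_vec T u i \<noteq> 0} \<subseteq> T" using embed_vec_outside by blast
  then show ?thesis unfolding nnz_def using fin by (rule card_mono[rotated])
qed

text \<open>Both oracles are called before \<open>z'\<close> is compared with \<open>y\<close>, so
  there is exactly one query of each kind whichever point wins.\<close>

lemma runs_sparse_step:
  assumes sym: "symmetric_set kind n K" and cl: "closedin (Euclidean_space n) K"
    and a: "0 < a" "0 < b" and y: "y \<in> K" and xs: "xs \<in> K" "nnz n xs \<le> s"
    and s: "1 \<le> s" "s \<le> n" "s < 2 ^ L"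
    and rep: "represents n s b \<beta>2 xt g A m y" and lam: "reals m ''lambda'' 0 = a"
    and my: "\<And>k. k < n \<Longrightarrow> reals m ''y'' k = y k"
    and mq: "\<And>k. k < n \<Longrightarrow> reals m ''q'' k = grad n Q y k"
  shows "runs n (\<lambda>T. projection (card T) (restrict_set K T)) (mat_vec n A)
    (select kind ;; Project ''idx'' (NV ''s'') ''src'' ''dst'' ;; scatter ;; Multiply ''zp'' ''hz'' ;; update)
    m (n * (9 * L + 52) + 36)
    (\<lambda>qs m'. \<exists>T u v w. qs = [Proj_Query T u, Mult_Query v] \<and> card T = s \<and> nnz n v \<le> s \<and>
       sparse_prox_step kind n s Q b K y a w \<and> wpo_output n Q b (set_indicator K) xs y a w \<and> w \<in> K \<and>
       (\<forall>k<n. reals m' ''w'' k = w k) \<and> (\<forall>k<n. reals m' ''y'' k = comb a y w k) \<and>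
       represents n s b \<beta>2 xt g A m' (comb a y w))"
    (is "runs n ?P ?H _ m _ ?Q")
proof -
  let ?N = "{''i'', ''p'', ''c'', ''t'', ''hp'', ''mark'', ''cnt'', ''idx''}"
  let ?R2 = "{''z'', ''lo'', ''key'', ''src''}"
  define z where "z = (\<lambda>i. y i - 1 / (a * b) * grad n Q y i)"
  have KR: "K \<subseteq> Rn n" using cl by (rule closedin_subset)
  have m: "nats m ''n'' 0 = n" "nats m ''s'' 0 = s" "reals m ''btilde'' 0 = b"
    using rep by (auto simp: represents_def)
  have z_eq: "z k = reals m ''y'' k - 1 / (reals m ''lambda'' 0 * reals m ''btilde'' 0) * reals m ''q'' k"
    if "k < n" for k
    using that by (simp add: z_def lam m my mq)
  let ?R = "\<lambda>m'. (\<exists>T. largest_set kind n s z T \<and> map (nats m' ''idx'') [0..<s] = sorted_list_of_set T \<and>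
       (\<forall>k<s. reals m' ''src'' k = z (sorted_list_of_set T ! k))) \<and> changes ?N ?R2 m m'"
  have rest: "runs n ?P ?H (Project ''idx'' (NV ''s'') ''src'' ''dst'' ;; scatter ;; Multiply ''zp'' ''hz'' ;; update)
      m2 (((6 * n + 4) + ((15 * n + 12) + 1)) + 1) ?Q" if R: "?R m2" for m2
  proof -
    obtain T where T: "largest_set kind n s z T"
      and idx: "map (nats m2 ''idx'') [0..<s] = sorted_list_of_set T"
      and src: "\<And>k. k < s \<Longrightarrow> reals m2 ''src'' k = z (sorted_list_of_set T ! k)"
      using R by blast
    have ch: "changes ?N ?R2 m m2" using R by blast
    have Tn: "T \<subseteq> {..<n}" "card T = s" using T by (auto simp: largest_set_def)
    have fin: "finite T" using Tn(1) finite_subset by blast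
    have m2: "nats m2 ''n'' 0 = n" "nats m2 ''s'' 0 = s"
      using m changes_nats[OF ch] by simp_all
    define p where "p = projection s (restrict_set K T) (restrict_vec T z)"
    define z' where "z' = embed_vec T p"
    define v where "v = inner_n n (vdiff z' y) (grad n Q y) + a * b / 2 * (norm_n n (vdiff z' y))\<^sup>2"
    define w where "w = (if v < 0 then z' else y)"
    note step = sparse_prox_step_correct[OF sym cl a y xs z_def T z'_def[unfolded p_def] v_def,
        folded w_def]
    have z'K: "z' \<in> K"
      using sparse_projection_nearest(1)[OF sym cl T xs] by (simp add: z'_def p_def)
    have nnz: "nnz n z' \<le> s" using nnz_embed_vec[OF Tn(1)] Tn(2) by (simp add: z'_def)
    \<comment> \<open>The scan stored \<open>z\<close> along \<open>T\<close> in increasing order,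
      which is the coordinate order of \<open>restrict_vec\<close>; the query is therefore the
      prescribed one.\<close>
    have blk: "block m2 ''src'' s = restrict_vec T z"
      using src Tn(2) by (auto simp: block_def restrict_vec_def)
    define m3 where "m3 = block_write ''dst'' s p m2"
    have m3: "nats m3 = nats m2" "\<And>k. k < s \<Longrightarrow> reals m3 ''dst'' k = p k"
      "changes ?N (insert ''dst'' ?R2) m m3"
      by (simp_all add: m3_def block_write_def)
        (rule changes_trans[OF ch, of "{}" "{''dst''}"]; simp add: changes_def block_write_def)
    have emb: "embed_vec T (reals m3 ''dst'') = z'"
      using m3(2) Tn(2) by (auto simp: z'_def embed_vec_def fun_eq_iff intro!: sum.cong)
    let ?R4 = "\<lambda>m4. (\<forall>j<n. reals m4 ''zp'' j = z' j) \<and> changes {''i''} {''zp''} m3 m4"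
    have scat: "runs n ?P ?H scatter m3 (6 * n + 4) (\<lambda>qs m4. qs = [] \<and> ?R4 m4)"
      using runs_scatter[of m3 n s T, unfolded emb] m2 Tn s idx by (simp add: m3(1))
    have upd: "runs n ?P ?H (Multiply ''zp'' ''hz'' ;; update) m4 ((15 * n + 12) + 1)
        (\<lambda>qs. ?Q (Proj_Query T (restrict_vec T z) # qs))" if R4: "?R4 m4" for m4
    proof -
      have ch4: "changes {''i''} {''zp''} m3 m4" using R4 by blast
      have b4: "block m4 ''zp'' n = z'" using R4 z'K KR by (intro block_eq) auto
      define m5 where "m5 = block_write ''hz'' n (mat_vec n A z') m4"
      have ch34: "changes ?N (?R2 \<union> {''dst'', ''zp''}) m m4"
        by (rule changes_trans[OF m3(3) ch4]) simp_all
      have ch5: "changes ?N (?R2 \<union> {''dst'', ''zp'', ''hz''}) m m5"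
        by (rule changes_trans[OF ch34, of "{}" "{''hz''}"]) (simp_all add: m5_def changes_def block_write_def)
      have m5: "nats m5 ''n'' 0 = n" "a = reals m5 ''lambda'' 0" "reals m5 ''btilde'' 0 = b"
        "reals m5 ''y'' = reals m ''y''" "reals m5 ''q'' = reals m ''q''" "reals m5 ''e'' = reals m ''e''"
        "reals m5 ''h'' = reals m ''h''" "reals m5 ''x'' = reals m ''x''"
        using m lam changes_nats[OF ch5] changes_reals[OF ch5] by simp_all
      have zp: "reals m5 ''zp'' k = z' k" "reals m5 ''hz'' k = mat_vec n A z' k" if "k < n" for k
        using R4 that by (simp_all add: m5_def block_write_def)
      have v: "v = (\<Sum>k<n. (reals m5 ''zp'' k - reals m5 ''y'' k) * reals m5 ''q'' k +
          a * reals m5 ''btilde'' 0 / 2 * (reals m5 ''zp'' k - reals m5 ''y'' k)\<^sup>2)"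
        unfolding v_def norm_n_power2 inner_n_def vdiff_def sum_distrib_left
        by (simp add: m5 zp my mq flip: sum.distrib)
      have w: "w k = (if v < 0 then reals m5 ''zp'' k else reals m5 ''y'' k)" if "k < n" for k
        using that by (simp add: w_def zp m5 my)
      have "runs n ?P ?H (Multiply ''zp'' ''hz'' ;; update) m4 ((15 * n + 12) + 1)
          (\<lambda>qs m'. qs = [Mult_Query z'] \<and> (\<forall>k<n. reals m' ''w'' k = w k) \<and>
           (\<forall>k<n. reals m' ''y'' k = comb a y w k) \<and> represents n s b \<beta>2 xt g A m' (comb a y w))"
      proof (rule runs_Seq_Multiply, unfold b4, fold m5_def,
          rule runs_mono[OF runs_update[OF m5(1,2) v w]], goal_cases)
        case (3 qs m')
        have "changes {''i''} {''val'', ''e'', ''w'', ''y'', ''d''} m5 m'" using 3 by blast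
        then have ch': "changes ?N (?R2 \<union> {''dst'', ''zp'', ''hz'', ''val'', ''e'', ''w'', ''y'', ''d''}) m m'"
          by (rule changes_trans[OF ch5]) simp_all
        have "represents n s b \<beta>2 xt g A m' (comb a y w)"
        proof (rule represents_changes[OF rep ch'])
          fix k assume k: "k < n"
          show "reals m' ''d'' k = vdiff (comb a y w) xt k"
            using 3 k rep by (simp add: m5 my vdiff_def comb_def represents_def)
          \<comment> \<open>This covers the case \<open>w = y\<close>, in which the stored Hessian
            product is left as it is.\<close>
          have "comb a y y = y" by (auto simp: comb_def algebra_simps)
          then show "reals m' ''e'' k = mat_vec n A (vdiff (comb a y w) xt) k"
            using 3 k rep mat_vec_comb[of n A a y z' xt k] by (simp add: m5 zp w_def represents_def)
        qed simp_all
        then show ?case using 3 by (simp add: m5 my comb_def)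
      qed simp_all
      then show ?thesis by (rule runs_mono) (use Tn nnz step in blast)+
    qed
    show ?thesis
    proof (rule runs_Seq_Project[where l = s, OF _ refl], goal_cases)
      case 1
      show ?case using m2 by simp
    next
      case 2
      then show ?case unfolding idx by simp
    next
      case 3
      then show ?case unfolding idx using Tn(1) fin by simp
    next
      case 4
      have "set (map (nats m2 ''idx'') [0..<s]) = T" unfolding idx using fin by simp
      moreover have "runs n ?P ?H (scatter ;; Multiply ''zp'' ''hz'' ;; update) m3
          ((6 * n + 4) + ((15 * n + 12) + 1)) (\<lambda>qs. ?Q (Proj_Query T (restrict_vec T z) # qs))"
        by (rule runs_Seq[OF scat upd])
      ultimately show ?case
        unfolding m3_def p_def by (simp only: blk Tn(2))
    qed
  qed
  have "runs n ?P ?H (select kind ;; Project ''idx'' (NV ''s'') ''src'' ''dst'' ;; scatter ;; Multiply ''zp'' ''hz'' ;; update)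
    m ((n * (9 * L + 31) + 18) + (((6 * n + 4) + ((15 * n + 12) + 1)) + 1)) ?Q"
    by (rule runs_Seq[OF runs_select[OF m(1,2) s z_eq] rest])
  then show ?thesis by (rule runs_mono) (simp_all add: algebra_simps)
qed

text \<open>Besides the resource bounds the conclusion returns what it assumed of the memory and the
  iterate, membership in \<open>K\<close> following from convexity, so that it can be
  repeated.\<close>

lemma iteration_step:
  assumes sym: "symmetric_set kind n K" and cl: "closedin (Euclidean_space n) K" and cv: "convex_n K"
    and b: "0 < b" and a: "a \<in> {0..1}" and y: "y \<in> K" and xs: "xs \<in> K" "nnz n xs \<le> s"
    and s: "1 \<le> s" "s \<le> n" and xt: "xt \<in> K" and C2: "C2_over n K f"
    and rep: "represents n s b \<beta>2 xt (grad n f xt) (hess n f xt) m y"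
  shows "\<exists>m' y'. implements_iteration (iteration asm kind) 124 kind n s (Q_model asm n f \<beta>2 xt) b K xs
      (hess n f xt) a m y m' y' \<and>
      represents n s b \<beta>2 xt (grad n f xt) (hess n f xt) m' y' \<and> y' \<in> K"
proof -
  let ?A = "hess n f xt" and ?g = "grad n f xt" and ?Q = "Q_model asm n f \<beta>2 xt"
  let ?P = "\<lambda>T. projection (card T) (restrict_set K T)" and ?H = "mat_vec n (hess n f xt)"
  let ?rep = "represents n s b \<beta>2 xt ?g ?A"
  have KR: "K \<subseteq> Rn n" using cl by (rule closedin_subset)
  \<comment> \<open>The integer part of the binary logarithm of \<open>s\<close>;
    \<open>Suc l\<close> bounds the number of levels of the heap.\<close>
  obtain l where l: "2 ^ l \<le> s" "s < 2 ^ Suc l" using ex_power_ivl1[of 2 s] s by auto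
  let ?fin = "\<lambda>qs m'. \<exists>w. wpo_output n ?Q b (set_indicator K) xs y a w \<and>
        (0 < a \<longrightarrow> sparse_prox_step kind n s ?Q b K y a w \<and> block m' ''w'' n = w) \<and>
        block m' ''y'' n = comb a y w \<and>
        length (proj_queries qs) \<le> 1 \<and> (\<forall>(T, u)\<in>set (proj_queries qs). card T = s) \<and>
        length (mult_queries qs) \<le> 1 \<and> (\<forall>v\<in>set (mult_queries qs). nnz n v \<le> s) \<and>
        ?rep m' (comb a y w) \<and> comb a y w \<in> K"
  define m0 where "m0 = real_write ''lambda'' 0 a m"
  have rep0: "?rep m0 y" using rep by (simp add: m0_def represents_def real_write_def)
  have m0: "nats m0 ''n'' 0 = n" "reals m0 ''beta2'' 0 = \<beta>2" "reals m0 ''lambda'' 0 = a"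
    using rep0 by (simp_all add: represents_def) (simp add: m0_def real_write_def)
  let ?R1 = "\<lambda>m'. (\<forall>k<n. reals m' ''y'' k = reals m0 ''x'' k + reals m0 ''d'' k) \<and>
     (\<forall>k<n. reals m' ''q'' k = reals m0 ''g'' k + reals m0 ''e'' k +
       (case asm of Assm_A \<Rightarrow> 0 | Assm_B \<Rightarrow> reals m0 ''beta2'' 0 / 2 * norm_n n (reals m0 ''d'') * reals m0 ''d'' k)) \<and>
     changes {''i''} {''y'', ''r'', ''q''} m0 m'"
  have 1: "runs n ?P ?H (gradient asm) m0 (9 * n + 8) (\<lambda>qs m'. qs = [] \<and> ?R1 m')"
    using m0(1) by (rule runs_gradient)
  have 2: "runs n ?P ?H (Cond (RLess (RConst 0) (RV ''lambda''))
       (select kind ;; Project ''idx'' (NV ''s'') ''src'' ''dst'' ;; scatter ;;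
        Multiply ''zp'' ''hz'' ;; update) Skip) m1 ((n * (9 * Suc l + 52) + 36) + 1) ?fin"
    if R1: "?R1 m1" for m1
  proof -
    have ch: "changes {''i''} {''y'', ''r'', ''q''} m0 m1" using R1 by blast
    have rep1: "?rep m1 y"
      by (rule represents_changes[OF rep0 ch])
        (use rep0 changes_reals[OF ch] in \<open>simp_all add: represents_def\<close>)
    have my: "reals m1 ''y'' k = y k" if "k < n" for k
      using that R1 rep0 by (simp add: represents_def vdiff_def)
    have nrm: "norm_n n (reals m0 ''d'') = norm_n n (vdiff y xt)"
      using rep0 by (intro norm_n_cong) (simp add: represents_def)
    have mq: "reals m1 ''q'' k = grad n ?Q y k" if "k < n" for k
      using that R1 rep0 partial_Q_model[OF C2 xt subsetD[OF KR xt] that, of asm \<beta>2 y]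
      by (simp add: represents_def nrm m0(2) grad_def cong: setting.case_cong)
    have lam: "reals m1 ''lambda'' 0 = a" using m0(3) changes_reals[OF ch] by simp
    have conv: "comb a y w \<in> K" if "w \<in> K" for w
      using cv y a that by (auto simp: convex_n_def)
    have blk: "block m' ''y'' n = comb a y w" if "w \<in> K" "\<forall>k<n. reals m' ''y'' k = comb a y w k" for m' w
      using conv[OF that(1)] KR that(2) by (intro block_eq) auto
    show ?thesis
    proof (rule runs_Cond)
      assume "bval (RLess (RConst 0) (RV ''lambda'')) m1"
      then have a0: "0 < a" using lam by simp
      show "runs n ?P ?H (select kind ;; Project ''idx'' (NV ''s'') ''src'' ''dst'' ;; scatter ;;
        Multiply ''zp'' ''hz'' ;; update) m1 (n * (9 * Suc l + 52) + 36) ?fin"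
      proof (rule runs_mono[OF runs_sparse_step[OF sym cl a0 b y xs s l(2) rep1 lam my mq]], goal_cases)
        case (4 qs m')
        then obtain T u v w where q: "qs = [Proj_Query T u, Mult_Query v]" "card T = s" "nnz n v \<le> s"
          and w: "sparse_prox_step kind n s ?Q b K y a w" "wpo_output n ?Q b (set_indicator K) xs y a w" "w \<in> K"
          and m': "\<forall>k<n. reals m' ''w'' k = w k" "\<forall>k<n. reals m' ''y'' k = comb a y w k"
            "?rep m' (comb a y w)"
          by blast
        have "block m' ''w'' n = w" using m'(1) w(3) KR by (intro block_eq) auto
        then show ?case
          using q w m'(3) blk[OF w(3) m'(2)] conv[OF w(3)]
          by (intro exI[of _ w]) (simp add: proj_queries_def mult_queries_def)
      qed simp_all
    next
      assume "\<not> bval (RLess (RConst 0) (RV ''lambda'')) m1"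
      then have a0: "a = 0" using lam a by simp
      obtain w where w: "w \<in> K" "wpo_output n ?Q b (set_indicator K) xs y a w"
        using wpo_output_exists[OF KR y xs(1)] by blast
      have cy: "comb 0 y w = y" by (simp add: comb_def)
      have "?fin [] m1"
        using w rep1 y a0 blk[OF w(1), of m1] my
        by (intro exI[of _ w]) (simp add: proj_queries_def mult_queries_def cy a0)
      then show "runs n ?P ?H Skip m1 (n * (9 * Suc l + 52) + 36) ?fin"
        by (intro runs_straight) simp_all
    qed
  qed
  have "runs n ?P ?H (iteration asm kind) m0 ((9 * n + 8) + ((n * (9 * Suc l + 52) + 36) + 1)) ?fin"
    unfolding iteration_def by (rule runs_Seq[OF 1 2])
  then obtain t qs m' w where ex: "exec n ?P ?H (iteration asm kind) m0 t qs m'"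
    and t: "t \<le> (9 * n + 8) + ((n * (9 * Suc l + 52) + 36) + 1)"
    and w: "wpo_output n ?Q b (set_indicator K) xs y a w"
        "0 < a \<longrightarrow> sparse_prox_step kind n s ?Q b K y a w \<and> block m' ''w'' n = w"
        "block m' ''y'' n = comb a y w"
        "length (proj_queries qs) \<le> 1" "\<forall>(T, u)\<in>set (proj_queries qs). card T = s"
        "length (mult_queries qs) \<le> 1" "\<forall>v\<in>set (mult_queries qs). nnz n v \<le> s"
        "?rep m' (comb a y w)" "comb a y w \<in> K"
    unfolding runs_def by blast
  have "real t \<le> 124 * (real n * max 1 (log 2 (real s)))"
  proof -
    \<comment> \<open>The additive constants total 45, at most 45 n because \<open>n\<close> is
      positive. Then 9 l + 115 is at most (9 + 115) times the larger of 1 and the logarithm, which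
      gives 124.\<close>
    have "t \<le> n * (9 * l + 70) + 45 * n" using t s by (simp add: algebra_simps)
    then have "t \<le> n * (9 * l + 115)" by (simp add: algebra_simps)
    then have "real t \<le> real (n * (9 * l + 115))" by (simp only: of_nat_le_iff)
    also have "\<dots> = real n * (9 * real l + 115)" by simp
    also have "\<dots> \<le> real n * (124 * max 1 (log 2 (real s)))"
    proof (rule mult_left_mono)
      have "real (2 ^ l) \<le> real s" using l(1) by (simp only: of_nat_le_iff)
      then have "real l \<le> log 2 (real s)" by (intro le_log_of_power) simp_all
      then show "9 * real l + 115 \<le> 124 * max 1 (log 2 (real s))" by linarith
    qed simp
    finally show ?thesis by simp
  qed
  then have "implements_iteration (iteration asm kind) 124 kind n s ?Q b K xs ?A a m y m' (comb a y w)"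
    unfolding implements_iteration_def using ex[unfolded m0_def] w(1-7)
    by (intro exI[of _ t] exI[of _ qs] exI[of _ w] conjI) (assumption | rule refl)+
  then show ?thesis using w(8,9) by blast
qed

section \<open>Positivity of the smoothness constant and the whole run\<close>

lemma beta_tilde_pos:
  assumes p: "problem asm n f (set_indicator K) \<alpha> \<beta> \<beta>2 x1 xt xs" and K: "K \<subseteq> Rn n"
  shows "0 < beta_tilde asm n (set_indicator K) \<beta> \<beta>2"
proof (cases asm)
  case Assm_A
  then show ?thesis using p by (simp add: problem_def assumption_A_def beta_tilde_def)
next
  case Assm_B
  have \<beta>: "0 < \<beta>" "0 \<le> \<beta>2" and bnd: "bounded_n n K" and xt: "xt \<in> K"
    using p Assm_B by (simp_all add: problem_def assumption_B_def eff_dom_set_indicator[OF K])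
  \<comment> \<open>The diameter is a supremum of reals, so boundedness is needed to place it above
    the distance of \<open>xt\<close> to itself, which is 0.\<close>
  have "bdd_above ((\<lambda>(x, y). norm_n n (vdiff x y)) ` (K \<times> K))"
    using bnd unfolding bounded_n_def bdd_above_def by fastforce
  then have "(\<lambda>(x, y). norm_n n (vdiff x y)) (xt, xt) \<le> diameter_n n K"
    unfolding diameter_n_def using xt by (intro cSUP_upper) auto
  then have "0 \<le> diameter_n n K" using norm_n_nonneg[of n "vdiff xt xt"] by simp
  then show ?thesis
    using \<beta> Assm_B by (simp add: beta_tilde_def eff_dom_set_indicator[OF K] add_pos_nonneg)
qed

text \<open>The objective is infinite off \<open>K\<close> and finite at \<open>xt\<close>.\<close>

lemma minimizer_in:
  assumes "{x. is_arg_min (obj f (set_indicator K)) (\<lambda>u. u \<in> Rn n) x} = {xs}" "xt \<in> K" "K \<subseteq> Rn n"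
  shows "xs \<in> K"
proof (rule ccontr)
  assume xs: "xs \<notin> K"
  have "is_arg_min (obj f (set_indicator K)) (\<lambda>u. u \<in> Rn n) xs" using assms(1) by blast
  then have "\<not> obj f (set_indicator K) xt < obj f (set_indicator K) xs"
    using assms(2,3) unfolding is_arg_min_def by blast
  then show False using xs assms(2) by (simp add: obj_def set_indicator_def)
qed

lemma represents_initial:
  "represents n s b \<beta>2 xt g A (initial_memory n s b \<beta>2 xt g (mat_vec n A xt)) xt"
  by (simp add: represents_def initial_memory_def vdiff_def mat_vec_def)

text \<open>The program depends only on which assumption holds and which symmetry \<open>K\<close>
  has; it and the constant are fixed before the dimension, the data and the step sizes.\<close>

theorem corollary1:
  fixes asm :: setting and kind :: symmetry
  shows "\<exists>prog C. \<forall>n s K f \<alpha> \<beta> \<beta>2 x1 xt xs.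
    closedin (Euclidean_space n) K \<longrightarrow> convex_n K \<longrightarrow> symmetric_set kind n K \<longrightarrow>
    problem asm n f (set_indicator K) \<alpha> \<beta> \<beta>2 x1 xt xs \<longrightarrow>
    1 \<le> s \<longrightarrow> s \<le> n \<longrightarrow> nnz n xs \<le> s \<longrightarrow>
    (\<forall>lam :: nat \<Rightarrow> real. (\<forall>i. lam i \<in> {0..1}) \<longrightarrow>
      (\<exists>mem y.
        mem 0 = initial_memory n s (beta_tilde asm n (set_indicator K) \<beta> \<beta>2) \<beta>2
                  xt (grad n f xt) (mat_vec n (hess n f xt) xt) \<and>
        y 0 = xt \<and>
        (\<forall>i. implements_iteration prog C kind n s (Q_model asm n f \<beta>2 xt)
               (beta_tilde asm n (set_indicator K) \<beta> \<beta>2) K xs (hess n f xt) (lam i)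
               (mem i) (y i) (mem (Suc i)) (y (Suc i)))))"
proof (rule exI[of _ "iteration asm kind"], rule exI[of _ 124], intro allI impI)
  fix n s K f \<alpha> \<beta> \<beta>2 x1 xt xs and lam :: "nat \<Rightarrow> real"
  assume cl: "closedin (Euclidean_space n) K" and cv: "convex_n K" and sym: "symmetric_set kind n K"
    and p: "problem asm n f (set_indicator K) \<alpha> \<beta> \<beta>2 x1 xt xs"
    and s: "1 \<le> s" "s \<le> n" and xs: "nnz n xs \<le> s" and lam: "\<forall>i. lam i \<in> {0..1}"
  let ?b = "beta_tilde asm n (set_indicator K) \<beta> \<beta>2"
  let ?m0 = "initial_memory n s ?b \<beta>2 xt (grad n f xt) (mat_vec n (hess n f xt) xt)"
  let ?impl = "\<lambda>a m y m' y'. implements_iteration (iteration asm kind) 124 kind n s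
    (Q_model asm n f \<beta>2 xt) ?b K xs (hess n f xt) a m y m' y'"
  let ?rep = "represents n s ?b \<beta>2 xt (grad n f xt) (hess n f xt)"
  have KR: "K \<subseteq> Rn n" using cl by (rule closedin_subset)
  have xt: "xt \<in> K" and C2: "C2_over n K f"
    and am: "{x. is_arg_min (obj f (set_indicator K)) (\<lambda>u. u \<in> Rn n) x} = {xs}"
    using p unfolding problem_def eff_dom_set_indicator[OF KR] by blast+
  \<comment> \<open>An iteration only asserts that some successor exists, so the run is obtained by
    dependent choice on pairs of memory and iterate. The clause for \<open>i = 0\<close> pins the
    start.\<close>
  let ?inv = "\<lambda>i h. ?rep (fst h) (snd h) \<and> snd h \<in> K \<and> (i = 0 \<longrightarrow> h = (?m0, xt))"
  have "\<exists>h. \<forall>i. ?inv i (h i) \<and>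
      ?impl (lam i) (fst (h i)) (snd (h i)) (fst (h (Suc i))) (snd (h (Suc i)))"
  proof (rule dependent_nat_choice)
    show "\<exists>h. ?inv (0::nat) h"
      using xt represents_initial by (intro exI[of _ "(?m0, xt)"]) simp
    fix h and i :: nat
    assume "?inv i h"
    then have h: "?rep (fst h) (snd h)" "snd h \<in> K" by blast+
    obtain m' y' where "?impl (lam i) (fst h) (snd h) m' y'" "?rep m' y'" "y' \<in> K"
      using iteration_step[OF sym cl cv beta_tilde_pos[OF p KR] spec[OF lam] h(2)
          minimizer_in[OF am xt KR] xs s xt C2 h(1)] by blast
    then show "\<exists>h'. ?inv (Suc i) h' \<and> ?impl (lam i) (fst h) (snd h) (fst h') (snd h')"
      by (intro exI[of _ "(m', y')"]) simp
  qed
  then obtain h where h: "\<forall>i. ?inv i (h i) \<and>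
      ?impl (lam i) (fst (h i)) (snd (h i)) (fst (h (Suc i))) (snd (h (Suc i)))" ..
  then have "h 0 = (?m0, xt)" by blast
  then show "\<exists>mem y. mem 0 = ?m0 \<and> y 0 = xt \<and> (\<forall>i. ?impl (lam i) (mem i) (y i) (mem (Suc i)) (y (Suc i)))"
    using h by (intro exI[of _ "\<lambda>i. fst (h i)"] exI[of _ "\<lambda>i. snd (h i)"]) simp
qed

end
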